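(* Let $M/F$ be a field extension of degree $n$ with non-trivial $G=\mathrm{Aut}_F(M)$, and let $A$ be a central simple algebra of degree $n$ over $F$ containing $M$. Then $G$ is solvable if there exists a chain of subalgebras $$M=A_0\subset A_1\subset\dots\subset A_k\subseteq A$$ of $A$ which all have maximal subfield $M$, where $A_k$ is a $G$-crossed product algebra over $\mathrm{Fix}(G)$, and where $$A_{i+1}\cong A_i[t_i;\tau_i]/A_i[t_i;\tau_i](t_i^{q_i}-c_i)$$ for all $i\in\{0,\dots,k-1\}$, with (i) $q_i$ a prime, (ii) $\tau_i$ an $F$-automorphism of $A_i$ of inner order $q_i$ which restricts (on $M$) to an automorphism $\sigma_{i+1}\in G$, and (iii) $c_i\in\mathrm{Fix}(\tau_i)^\times$.
   Context: $\mathrm{Aut}_F(M)$ is the group of field automorphisms of $M$ fixing $F$ pointwise; $\mathrm{Fix}(G)$ is its fixed field in $M$. A central simple algebra has degree $n$ over $F$ if it has dimension $n^2$. A $G$-crossed product algebra over a field $Z$ is a central simple $Z$-algebra of degree $e$ containing a field extension $M/Z$ which is Galois of degree $e$ with Galois group $G$ (here the given field $M$). For a ring $B$ and an automorphism $\tau$ of $B$, $B[t;\tau]$ is the twisted polynomial ring with $tb=\tau(b)t$. For monic $f\in B[t;\tau]$ of degree $q$, $B[t;\tau]/B[t;\tau]f$ denotes the set of polynomials of degree $<q$ with multiplication $g\circ h=$ the remainder of $gh$ after right division by $f$ (the unique $r$ with $\deg r<q$ and $gh=q_1f+r$); when $B[t;\tau]f$ is a two-sided ideal this is the quotient ring. $\mathrm{Fix}(\tau)=\{b\in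 B:\tau(b)=b\}$, and $\mathrm{Fix}(\tau)^\times$ is its set of invertible elements. The inner order of an automorphism $\tau$ is the smallest positive integer $e$ such that $\tau^e$ is an inner automorphism $x\mapsto uxu^{-1}$ ($u$ a unit). An $F$-automorphism is a ring automorphism fixing $F$ pointwise. *)

theory Defs
  imports "HOL-Algebra.Algebra"
begin

text \<open>All algebras over a field \<open>F\<close> are (sub)rings containing \<open>F\<close> as a central subfield, so
  the field, its extensions and the algebras are subsets of one ambient ring, and the ring
  structure on a subset \<open>B\<close> is \<^term>\<open>R\<lparr>carrier := B\<rparr>\<close>.\<close>

definition ring_center :: "('a, 'b) ring_scheme \<Rightarrow> 'a set"
  where "ring_center R = {z \<in> carrier R. \<forall>x \<in> carrier R. z \<otimes>\<^bsub>R\<^esub> x = x \<otimes>\<^bsub>R\<^esub> z}"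

definition simple_ring :: "('a, 'b) ring_scheme \<Rightarrow> bool"
  where "simple_ring R \<longleftrightarrow> ring R \<and> \<one>\<^bsub>R\<^esub> \<noteq> \<zero>\<^bsub>R\<^esub> \<and>
    (\<forall>I. ideal I R \<longrightarrow> I = {\<zero>\<^bsub>R\<^esub>} \<or> I = carrier R)"

definition central_simple_algebra :: "('a, 'b) ring_scheme \<Rightarrow> 'a set \<Rightarrow> nat \<Rightarrow> bool"
  where "central_simple_algebra R Z d \<longleftrightarrow>
    simple_ring R \<and> subfield Z R \<and> ring_center R = Z \<and> ring.dimension R (d\<^sup>2) Z (carrier R)"

definition maximal_subfield :: "'a set \<Rightarrow> ('a, 'b) ring_scheme \<Rightarrow> bool"
  where "maximal_subfield M R \<longleftrightarrow> subfield M R \<and> (\<forall>L. subfield L R \<and> M \<subseteq> L \<longrightarrow> L = M)"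

text \<open>Field automorphisms of \<open>M\<close> fixing \<open>F\<close> pointwise; they are extensional on \<open>M\<close> (through
  \<^const>\<open>Bij\<close>), so that equality of automorphisms is equality of functions.\<close>

definition field_aut_group :: "('a, 'b) ring_scheme \<Rightarrow> 'a set \<Rightarrow> 'a set \<Rightarrow> ('a \<Rightarrow> 'a) monoid"
  where "field_aut_group R F M = (BijGroup M)
    \<lparr>carrier := {\<sigma> \<in> Bij M. \<sigma> \<in> ring_hom (R\<lparr>carrier := M\<rparr>) (R\<lparr>carrier := M\<rparr>) \<and> (\<forall>x \<in> F. \<sigma> x = x)}\<rparr>"

definition fixed_points :: "('a \<Rightarrow> 'a) set \<Rightarrow> 'a set \<Rightarrow> 'a set"
  where "fixed_points S B = {b \<in> B. \<forall>\<sigma> \<in> S. \<sigma> b = b}"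

definition galois_extension ::
    "('a, 'b) ring_scheme \<Rightarrow> 'a set \<Rightarrow> 'a set \<Rightarrow> nat \<Rightarrow> ('a \<Rightarrow> 'a) monoid \<Rightarrow> bool"
  where "galois_extension R Z M e G \<longleftrightarrow>
    subfield Z R \<and> subfield M R \<and> Z \<subseteq> M \<and> ring.dimension R e Z M \<and>
    fixed_points (carrier (field_aut_group R Z M)) M = Z \<and> field_aut_group R Z M = G"

definition crossed_product_algebra ::
    "('a, 'b) ring_scheme \<Rightarrow> 'a set \<Rightarrow> 'a set \<Rightarrow> ('a \<Rightarrow> 'a) monoid \<Rightarrow> bool"
  where "crossed_product_algebra R Z M G \<longleftrightarrow>
    (\<exists>e. central_simple_algebra R Z e \<and> galois_extension R Z M e G)"

definition inner_automorphism :: "('a, 'b) ring_scheme \<Rightarrow> ('a \<Rightarrow> 'a) \<Rightarrow> bool"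
  where "inner_automorphism R \<tau> \<longleftrightarrow>
    (\<exists>u \<in> Units R. \<forall>x \<in> carrier R. \<tau> x = u \<otimes>\<^bsub>R\<^esub> x \<otimes>\<^bsub>R\<^esub> inv\<^bsub>R\<^esub> u)"

definition has_inner_order :: "('a, 'b) ring_scheme \<Rightarrow> ('a \<Rightarrow> 'a) \<Rightarrow> nat \<Rightarrow> bool"
  where "has_inner_order R \<tau> e \<longleftrightarrow> 0 < e \<and> inner_automorphism R (\<tau> ^^ e) \<and>
    (\<forall>j. 0 < j \<and> j < e \<longrightarrow> \<not> inner_automorphism R (\<tau> ^^ j))"

text \<open>The twisted polynomial ring, as coefficient sequences of finite support (the carrier
  \<^term>\<open>up R\<close> of the library's polynomial ring).  The product comes from
  \<open>(a t\<^sup>i) (b t\<^sup>j) = a \<tau>\<^sup>i(b) t\<^sup>i\<^sup>+\<^sup>j\<close>, that is, \<open>t b = \<tau>(b) t\<close>.\<close>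

definition skew_poly :: "('a, 'b) ring_scheme \<Rightarrow> ('a \<Rightarrow> 'a) \<Rightarrow> (nat \<Rightarrow> 'a) ring"
  where "skew_poly R \<tau> = \<lparr>
    carrier = up R,
    monoid.mult = (\<lambda>f g n. \<Oplus>\<^bsub>R\<^esub>i \<in> {..n}. f i \<otimes>\<^bsub>R\<^esub> (\<tau> ^^ i) (g (n - i))),
    monoid.one = (\<lambda>n. if n = 0 then \<one>\<^bsub>R\<^esub> else \<zero>\<^bsub>R\<^esub>),
    ring.zero = (\<lambda>n. \<zero>\<^bsub>R\<^esub>),
    ring.add = (\<lambda>f g n. f n \<oplus>\<^bsub>R\<^esub> g n)\<rparr>"

definition const_poly :: "('a, 'b) ring_scheme \<Rightarrow> 'a \<Rightarrow> nat \<Rightarrow> 'a"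
  where "const_poly R a = (\<lambda>n. if n = 0 then a else \<zero>\<^bsub>R\<^esub>)"

definition var_poly :: "('a, 'b) ring_scheme \<Rightarrow> nat \<Rightarrow> 'a"
  where "var_poly R = (\<lambda>n. if n = 1 then \<one>\<^bsub>R\<^esub> else \<zero>\<^bsub>R\<^esub>)"

text \<open>For monic \<open>f\<close>, the polynomials of degree less than \<open>deg f\<close>, multiplied modulo right division
  by \<open>f\<close>.  In general this is only a nonassociative ring.\<close>

definition skew_poly_quotient ::
    "('a, 'b) ring_scheme \<Rightarrow> ('a \<Rightarrow> 'a) \<Rightarrow> (nat \<Rightarrow> 'a) \<Rightarrow> (nat \<Rightarrow> 'a) ring"
  where "skew_poly_quotient R \<tau> f =
    (let P = skew_poly R \<tau>; C = {g \<in> up R. \<forall>n \<ge> deg R f. g n = \<zero>\<^bsub>R\<^esub>}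
     in P\<lparr>carrier := C,
          monoid.mult := (\<lambda>g h. THE r. r \<in> C \<and>
            (\<exists>s \<in> carrier P. g \<otimes>\<^bsub>P\<^esub> h = s \<otimes>\<^bsub>P\<^esub> f \<oplus>\<^bsub>P\<^esub> r))\<rparr>)"

definition skew_binomial :: "('a, 'b) ring_scheme \<Rightarrow> ('a \<Rightarrow> 'a) \<Rightarrow> nat \<Rightarrow> 'a \<Rightarrow> nat \<Rightarrow> 'a"
  where "skew_binomial R \<tau> q c =
    var_poly R [^]\<^bsub>skew_poly R \<tau>\<^esub> q \<ominus>\<^bsub>skew_poly R \<tau>\<^esub> const_poly R c"

text \<open>Isomorphism of \<open>F\<close>-algebras, where \<open>F\<close> is a subset of \<open>R\<close> and acts on \<open>S\<close> through \<open>\<iota>\<close>.\<close>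

definition algebra_isomorphic ::
    "'a set \<Rightarrow> ('a, 'b) ring_scheme \<Rightarrow> ('c, 'd) ring_scheme \<Rightarrow> ('a \<Rightarrow> 'c) \<Rightarrow> bool"
  where "algebra_isomorphic F R S \<iota> \<longleftrightarrow> (\<exists>h \<in> ring_iso R S. \<forall>a \<in> F. h a = \<iota> a)"

end

theory Submission
  imports Defs
begin

text \<open>The proof follows the centres of the algebras. Write \<open>Z\<^sub>i\<close> for the centre of
  \<open>A\<^sub>i = B i\<close>. Because \<open>\<tau>\<^sub>i\<close> has inner order \<open>q\<^sub>i\<close>, an element of
  \<open>A\<^sub>i\<close> that intertwines two different powers \<open>\<tau>\<^sub>i\<^sup>d\<close>, \<open>\<tau>\<^sub>i\<^sup>e\<close>
  with \<open>d, e < q\<^sub>i\<close> must vanish when \<open>A\<^sub>i\<close> is simple. This one observation shows that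
  \<open>A\<^sub>i[t;\<tau>\<^sub>i]/(t\<^sup>q - c)\<close> is again simple and that its centre consists of the constants from
  \<open>Z\<^sub>i\<close> that \<open>\<tau>\<^sub>i\<close> fixes. So every \<open>A\<^sub>i\<close> is simple, and
  \<open>Z\<^sub>i\<^sub>+\<^sub>1\<close> is isomorphic over \<open>F\<close> to the fixed field in \<open>Z\<^sub>i\<close> of an automorphism
  of finite order. Composing these isomorphisms embeds every \<open>Z\<^sub>i\<close> into \<open>M\<close> over \<open>F\<close>,
  with \<open>Z\<^sub>0 = M\<close>, while \<open>Z\<^sub>k\<close> is \<open>Fix(G)\<close> by the crossed product hypothesis.

  The given isomorphisms need only respect \<open>F\<close>, so the image of \<open>Fix(G)\<close> under the composed
  embedding \<open>f\<close> may differ from \<open>Fix(G)\<close>, and the isomorphism of \<open>Fix(G)\<close> with that image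
  need not extend to \<open>M\<close>. It does extend to a normal closure \<open>L\<close> of \<open>M/F\<close>. Let
  \<open>\<Gamma> = Aut\<^sub>F(L)\<close>, a finite group, let \<open>U\<close> be the subgroup fixing \<open>M\<close>, let
  \<open>P\<^sub>i\<close> fix the image of \<open>Z\<^sub>i\<close>, and let \<open>P\<close> fix \<open>Fix(G)\<close> itself. Elements of
  \<open>P\<^sub>i\<^sub>+\<^sub>1\<close> act on the image of \<open>Z\<^sub>i\<close> as powers of \<open>\<tau>\<^sub>i\<close>, by
  independence of characters, hence they commute there and the derived group of
  \<open>P\<^sub>i\<^sub>+\<^sub>1\<close> lies in \<open>P\<^sub>i\<close>. After \<open>k\<close> steps the derived series of \<open>P\<^sub>k\<close>
  is inside \<open>P\<^sub>0 = U\<close>.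

  Finally \<open>P\<close> and \<open>P\<^sub>k\<close> are conjugate in \<open>\<Gamma>\<close>, so the members of their derived
  series have equal orders; since \<open>U\<close> is a subgroup of \<open>P\<close>, counting forces the derived
  series of \<open>P\<close> to reach \<open>U\<close> as well. Restriction to \<open>M\<close> maps \<open>P\<close> onto \<open>G\<close> with
  kernel \<open>U\<close>, and \<open>G\<close> is solvable.

  The carrying lemmas are \<open>center_skew_quot\<close> and \<open>one_in_twosided\<close> (algebra),
  \<open>homs_eq_on_fixed_field\<close> and \<open>exists_normal_closure\<close> (fields),
  \<open>derived_fixing_group_cyclic\<close> (one step of the chain) and
  \<open>derived_exp_subset_of_conjugate\<close> (the counting argument).\<close>

section \<open>Derived series of conjugate subgroups\<close>

lemma (in group) group_hom_conjugation:
  assumes g: "g \<in> carrier G"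
  shows "group_hom G G (\<lambda>x. g \<otimes> x \<otimes> inv g)"
proof unfold_locales
  have cancel: "inv g \<otimes> (g \<otimes> z) = z" if "z \<in> carrier G" for z
    using g that by (simp add: m_assoc[symmetric])
  have "g \<otimes> (x \<otimes> y) \<otimes> inv g = g \<otimes> x \<otimes> inv g \<otimes> (g \<otimes> y \<otimes> inv g)"
    if "x \<in> carrier G" "y \<in> carrier G" for x y
    using g that by (simp add: m_assoc cancel)
  then show "(\<lambda>x. g \<otimes> x \<otimes> inv g) \<in> hom G G"
    using g by (auto simp: hom_def)
qed

lemma (in group) card_derived_exp_conjugate:
  assumes g: "g \<in> carrier G" and P: "P \<subseteq> carrier G"
  shows "card ((derived G ^^ n) ((\<lambda>x. g \<otimes> x \<otimes> inv g) ` P)) = card ((derived G ^^ n) P)"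
proof -
  have "inj_on (\<lambda>x. g \<otimes> x \<otimes> inv g) ((derived G ^^ n) P)"
  proof (rule inj_on_subset[OF _ exp_of_derived_in_carrier[OF P]])
    show "inj_on (\<lambda>x. g \<otimes> x \<otimes> inv g) (carrier G)"
      using g by (auto intro!: inj_onI)
  qed
  then show ?thesis
    using group_hom.exp_of_derived_img[OF group_hom_conjugation[OF g] P, of n]
    by (simp add: card_image)
qed

lemma (in group) derived_exp_antimono:
  assumes P: "subgroup P G"
  shows "(derived G ^^ (i + j)) P \<subseteq> (derived G ^^ i) P"
proof (induction j)
  case (Suc j)
  have "(derived G ^^ Suc (i + j)) P \<subseteq> (derived G ^^ (i + j)) P"
    using derived_incl[OF subset_refl exp_of_derived_is_subgroup[OF P]] by simp
  with Suc show ?case by simp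
qed simp

text \<open>Write \<open>D\<close> for the derived subgroup and choose \<open>J\<close> such that the order of \<open>D\<^sup>J P\<close> is minimal, so that \<open>D\<^sup>J\<^sup>+\<^sup>k P\<close> has the
  same order. The conjugate \<open>P'\<close> has derived groups of the same orders as \<open>P\<close>, but
  \<open>D\<^sup>J\<^sup>+\<^sup>k P' = D\<^sup>J (D\<^sup>k P')\<close> lies in \<open>D\<^sup>J U\<close>, hence in \<open>D\<^sup>J P\<close>. Comparing orders,
  \<open>D\<^sup>J P = D\<^sup>J U\<close>. Only orders can be compared here: conjugation by \<open>g\<close> need not preserve
  \<open>U\<close>, so it relates no quotient of \<open>P'\<close> by \<open>U\<close> to the quotient \<open>P/U\<close>.\<close>

lemma (in group) derived_exp_subset_of_conjugate:
  assumes fin: "finite (carrier G)" and P: "subgroup P G"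
    and U: "subgroup U G" "U \<subseteq> P" and g: "g \<in> carrier G"
    and sub: "(derived G ^^ k) ((\<lambda>x. g \<otimes> x \<otimes> inv g) ` P) \<subseteq> U"
  shows "\<exists>n. (derived G ^^ n) P \<subseteq> U"
proof -
  let ?D = "\<lambda>j. (derived G ^^ j)"
  let ?P' = "(\<lambda>x. g \<otimes> x \<otimes> inv g) ` P"
  have PC: "P \<subseteq> carrier G" using P by (rule subgroup.subset)
  have finD: "finite (?D j P)" for j
    using exp_of_derived_in_carrier[OF PC] fin by (rule finite_subset)
  define J where "J = (ARG_MIN (\<lambda>j. card (?D j P)) j. True)"
  have "card (?D J P) \<le> card (?D (J + k) P)"
    unfolding J_def by (rule arg_min_nat_le) simp
  with card_mono[OF finD derived_exp_antimono[OF P]]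
  have stable: "card (?D (J + k) P) = card (?D J P)" by (simp add: le_antisym)
  have "?D (J + k) ?P' = ?D J (?D k ?P')" by (simp add: funpow_add)
  also have "\<dots> \<subseteq> ?D J U" by (rule mono_exp_of_derived[OF sub])
  finally have le: "?D (J + k) ?P' \<subseteq> ?D J U" .
  have "card (?D (J + k) ?P') = card (?D J P)"
    unfolding card_derived_exp_conjugate[OF g PC] by (rule stable)
  moreover have "?D (J + k) ?P' \<subseteq> ?D J P"
    using le mono_exp_of_derived[OF U(2)] by blast
  ultimately have "?D (J + k) ?P' = ?D J P"
    using card_subset_eq[OF finD] by blast
  moreover have "?D J U \<subseteq> U"
    using derived_exp_antimono[OF U(1), of 0 J] by simp
  ultimately show ?thesis using le by blast
qed

lemma (in group) derived_exp_subgroup_consistent: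
  assumes P: "subgroup P G"
  shows "(derived (G\<lparr>carrier := P\<rparr>) ^^ n) P = (derived G ^^ n) P"
proof (induction n)
  case (Suc n)
  have "(derived G ^^ n) P \<subseteq> P" using derived_exp_antimono[OF P, of 0 n] by simp
  then show ?case using Suc derived_consistent[OF _ P] by simp
qed simp

section \<open>Groups of field automorphisms\<close>

lemma field_aut_group_simps:
  "\<one>\<^bsub>field_aut_group A F M\<^esub> = (\<lambda>x\<in>M. x)"
  "s \<in> carrier (field_aut_group A F M) \<Longrightarrow> t \<in> carrier (field_aut_group A F M) \<Longrightarrow>
    s \<otimes>\<^bsub>field_aut_group A F M\<^esub> t = compose M s t"
  by (auto simp: field_aut_group_def BijGroup_def)

lemma field_aut_groupD:
  assumes "s \<in> carrier (field_aut_group A F M)"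
  shows "s \<in> Bij M" "s \<in> extensional M" "bij_betw s M M"
    "s \<in> ring_hom (A\<lparr>carrier := M\<rparr>) (A\<lparr>carrier := M\<rparr>)" "\<And>x. x \<in> F \<Longrightarrow> s x = x"
    "\<And>x. x \<in> M \<Longrightarrow> s x \<in> M"
  using assms by (auto simp: field_aut_group_def Bij_def bij_betw_def)

lemma field_aut_groupI:
  assumes "s \<in> extensional M" "bij_betw s M M"
    "s \<in> ring_hom (A\<lparr>carrier := M\<rparr>) (A\<lparr>carrier := M\<rparr>)" "\<And>x. x \<in> F \<Longrightarrow> s x = x"
  shows "s \<in> carrier (field_aut_group A F M)"
  using assms by (auto simp: field_aut_group_def Bij_def)

lemma (in ring) subgroup_field_aut_group:
  assumes M: "subring M R" and F: "F \<subseteq> M"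
  shows "subgroup (carrier (field_aut_group R F M)) (BijGroup M)"
proof
  show "carrier (field_aut_group R F M) \<subseteq> carrier (BijGroup M)"
    by (auto simp: field_aut_group_def BijGroup_def)
  show "\<one>\<^bsub>BijGroup M\<^esub> \<in> carrier (field_aut_group R F M)"
    using F subringE[OF M] by (auto simp: field_aut_group_def BijGroup_def id_Bij ring_hom_def)
next
  fix s t assume st: "s \<in> carrier (field_aut_group R F M)" "t \<in> carrier (field_aut_group R F M)"
  have "compose M s t \<in> carrier (field_aut_group R F M)"
  proof (rule field_aut_groupI)
    show "bij_betw (compose M s t) M M"
      using field_aut_groupD(1)[OF st(1)] field_aut_groupD(1)[OF st(2)] compose_Bij
      by (auto simp: Bij_def)
    show "compose M s t \<in> ring_hom (R\<lparr>carrier := M\<rparr>) (R\<lparr>carrier := M\<rparr>)"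
      using subringE[OF M] field_aut_groupD(4,6)[OF st(1)] field_aut_groupD(4,6)[OF st(2)]
      by (auto simp: ring_hom_def compose_def)
    show "compose M s t x = x" if "x \<in> F" for x
      using that F field_aut_groupD(5)[OF st(1)] field_aut_groupD(5)[OF st(2)]
      by (auto simp: compose_def)
  qed simp
  then show "s \<otimes>\<^bsub>BijGroup M\<^esub> t \<in> carrier (field_aut_group R F M)"
    using field_aut_groupD(1)[OF st(1)] field_aut_groupD(1)[OF st(2)]
    by (simp add: BijGroup_def)
next
  fix s assume s: "s \<in> carrier (field_aut_group R F M)"
  note s' = field_aut_groupD[OF s]
  let ?i = "restrict (inv_into M s) M"
  have im: "s ` M = M" and inj: "inj_on s M" using s'(3) by (auto simp: bij_betw_def)
  have iM: "inv_into M s x \<in> M" "s (inv_into M s x) = x" if "x \<in> M" for x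
    using that im by (auto simp: inv_into_into f_inv_into_f)
  have eqI: "inv_into M s x = y" if "s y = x" "y \<in> M" for x y
    using that inj by (metis inv_into_f_f)
  have "?i \<in> carrier (field_aut_group R F M)"
  proof (rule field_aut_groupI)
    show "bij_betw ?i M M" using restrict_inv_into_Bij[OF s'(1)] by (auto simp: Bij_def)
    show "?i \<in> ring_hom (R\<lparr>carrier := M\<rparr>) (R\<lparr>carrier := M\<rparr>)"
    proof (rule ring_hom_memI)
      fix x y assume xy: "x \<in> carrier (R\<lparr>carrier := M\<rparr>)" "y \<in> carrier (R\<lparr>carrier := M\<rparr>)"
      then show "?i x \<in> carrier (R\<lparr>carrier := M\<rparr>)" using iM by simp
      show "?i (x \<otimes>\<^bsub>R\<lparr>carrier := M\<rparr>\<^esub> y) = ?i x \<otimes>\<^bsub>R\<lparr>carrier := M\<rparr>\<^esub> ?i y"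
        using xy iM subringE(6)[OF M] ring_hom_mult[OF s'(4)] by (auto intro!: eqI)
      show "?i (x \<oplus>\<^bsub>R\<lparr>carrier := M\<rparr>\<^esub> y) = ?i x \<oplus>\<^bsub>R\<lparr>carrier := M\<rparr>\<^esub> ?i y"
        using xy iM subringE(7)[OF M] ring_hom_add[OF s'(4)] by (auto intro!: eqI)
    next
      show "?i \<one>\<^bsub>R\<lparr>carrier := M\<rparr>\<^esub> = \<one>\<^bsub>R\<lparr>carrier := M\<rparr>\<^esub>"
        using subringE(3)[OF M] ring_hom_one[OF s'(4)] by (auto intro!: eqI)
    qed
    show "?i x = x" if "x \<in> F" for x
      using that F s'(5) by (auto intro!: eqI)
  qed simp
  then show "inv\<^bsub>BijGroup M\<^esub> s \<in> carrier (field_aut_group R F M)"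
    by (simp add: inv_BijGroup[OF s'(1)])
qed

lemma (in ring) group_field_aut_group:
  assumes "subring M R" "F \<subseteq> M"
  shows "group (field_aut_group R F M)"
  using subgroup.subgroup_is_group[OF subgroup_field_aut_group[OF assms] group_BijGroup]
  by (simp add: field_aut_group_def)

section \<open>Homomorphisms that agree on a fixed field\<close>

text \<open>Dedekind's independence of characters. Subtracting \<open>\<phi>(y)\<close> times the relation at \<open>x\<close> from the
  relation at \<open>yx\<close> removes the character \<open>\<phi>\<close> and multiplies the coefficient of every other
  \<open>\<psi>\<close> by \<open>\<psi>(y) - \<phi>(y)\<close>, which is non-zero for a suitable \<open>y\<close>.\<close>

lemma (in field) characters_independent:
  assumes E: "monoid E" and T: "finite T"
    and hom: "\<And>\<chi>. \<chi> \<in> T \<Longrightarrow> \<chi> \<in> hom E R \<and> \<chi> \<one>\<^bsub>E\<^esub> = \<one>"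
    and dist: "\<And>\<chi> \<psi>. \<chi> \<in> T \<Longrightarrow> \<psi> \<in> T \<Longrightarrow> \<chi> \<noteq> \<psi> \<Longrightarrow> \<exists>x\<in>carrier E. \<chi> x \<noteq> \<psi> x"
    and a: "\<And>\<chi>. \<chi> \<in> T \<Longrightarrow> a \<chi> \<in> carrier R"
    and zero: "\<And>x. x \<in> carrier E \<Longrightarrow> (\<Oplus>\<chi>\<in>T. a \<chi> \<otimes> \<chi> x) = \<zero>"
    and mem: "\<chi> \<in> T"
  shows "a \<chi> = \<zero>"
  using T hom dist a zero mem
proof (induction T arbitrary: a \<chi> rule: finite_induct)
  case (insert \<phi> T)
  interpret E: monoid E by (rule E)
  have cl: "\<psi> x \<in> carrier R" if "\<psi> \<in> insert \<phi> T" "x \<in> carrier E" for \<psi> x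
    using insert.prems(1)[OF that(1)] that(2) by (auto simp: hom_def)
  have ml: "\<psi> (x \<otimes>\<^bsub>E\<^esub> y) = \<psi> x \<otimes> \<psi> y"
    if "\<psi> \<in> insert \<phi> T" "x \<in> carrier E" "y \<in> carrier E" for \<psi> x y
    using insert.prems(1)[OF that(1)] that(2,3) by (auto simp: hom_def)
  have rest: "a \<psi> = \<zero>" if \<psi>: "\<psi> \<in> T" for \<psi>
  proof -
    have "\<psi> \<noteq> \<phi>" using \<psi> insert.hyps by auto
    then obtain y where y: "y \<in> carrier E" "\<psi> y \<noteq> \<phi> y"
      using insert.prems(2)[of \<psi> \<phi>] \<psi> by auto
    define b where "b \<psi> = a \<psi> \<otimes> (\<psi> y \<ominus> \<phi> y)" for \<psi>
    have "b \<psi> = \<zero>"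
    proof (rule insert.IH[OF _ _ _ _ \<psi>])
      show "b \<psi> \<in> carrier R" if "\<psi> \<in> T" for \<psi>
        using that insert.prems(3) cl y(1) by (auto simp: b_def)
      show "(\<Oplus>\<psi>\<in>T. b \<psi> \<otimes> \<psi> x) = \<zero>" if x: "x \<in> carrier E" for x
      proof -
        have fin: "finite (insert \<phi> T)" using insert.hyps by simp
        have alg: "p \<otimes> (q \<ominus> r) \<otimes> s = p \<otimes> (q \<otimes> s) \<oplus> (\<ominus> \<one>) \<otimes> (r \<otimes> (p \<otimes> s))"
          if "p \<in> carrier R" "q \<in> carrier R" "r \<in> carrier R" "s \<in> carrier R" for p q r s
          using that by (simp add: a_minus_def l_distr r_distr l_minus r_minus m_ac)
        let ?f = "\<lambda>\<psi>. a \<psi> \<otimes> \<psi> (y \<otimes>\<^bsub>E\<^esub> x)"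
        let ?g = "\<lambda>\<psi>. \<phi> y \<otimes> (a \<psi> \<otimes> \<psi> x)"
        have mem: "?f \<psi> \<in> carrier R" "?g \<psi> \<in> carrier R" if "\<psi> \<in> insert \<phi> T" for \<psi>
          using that insert.prems(3) cl x y(1) by auto
        have "(\<Oplus>\<psi>\<in>insert \<phi> T. b \<psi> \<otimes> \<psi> x) = (\<Oplus>\<psi>\<in>insert \<phi> T. ?f \<psi> \<oplus> (\<ominus> \<one>) \<otimes> ?g \<psi>)"
        proof (rule finsum_cong'[OF refl])
          show "b \<psi> \<otimes> \<psi> x = ?f \<psi> \<oplus> (\<ominus> \<one>) \<otimes> ?g \<psi>" if "\<psi> \<in> insert \<phi> T" for \<psi>
            using that insert.prems(3)[OF that] cl[OF that] cl[of \<phi>] x y(1)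
            unfolding b_def ml[OF that y(1) x] by (simp add: alg)
        qed (use mem in auto)
        also have "\<dots> = (\<Oplus>\<psi>\<in>insert \<phi> T. ?f \<psi>) \<oplus> (\<Oplus>\<psi>\<in>insert \<phi> T. (\<ominus> \<one>) \<otimes> ?g \<psi>)"
          using mem by (intro finsum_addf) auto
        also have "(\<Oplus>\<psi>\<in>insert \<phi> T. (\<ominus> \<one>) \<otimes> ?g \<psi>) = (\<ominus> \<one>) \<otimes> (\<Oplus>\<psi>\<in>insert \<phi> T. ?g \<psi>)"
          using mem fin by (subst finsum_rdistr) auto
        also have "(\<Oplus>\<psi>\<in>insert \<phi> T. ?g \<psi>) = \<phi> y \<otimes> (\<Oplus>\<psi>\<in>insert \<phi> T. a \<psi> \<otimes> \<psi> x)"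
          using fin cl insert.prems(3) x y(1) by (subst finsum_rdistr) auto
        also have "(\<Oplus>\<psi>\<in>insert \<phi> T. a \<psi> \<otimes> \<psi> x) = \<zero>"
          by (rule insert.prems(4)[OF x])
        also have "(\<Oplus>\<psi>\<in>insert \<phi> T. ?f \<psi>) = \<zero>"
          by (rule insert.prems(4)) (use x y(1) in simp)
        finally have s: "(\<Oplus>\<psi>\<in>insert \<phi> T. b \<psi> \<otimes> \<psi> x) = \<zero>"
          using cl y(1) by simp
        have bc: "b \<psi> \<otimes> \<psi> x \<in> carrier R" if "\<psi> \<in> insert \<phi> T" for \<psi>
          using that insert.prems(3) cl x y(1) by (auto simp: b_def)
        have "(\<Oplus>\<psi>\<in>insert \<phi> T. b \<psi> \<otimes> \<psi> x) = b \<phi> \<otimes> \<phi> x \<oplus> (\<Oplus>\<psi>\<in>T. b \<psi> \<otimes> \<psi> x)"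
          using insert.hyps bc by (intro finsum_insert) auto
        moreover have "b \<phi> = \<zero>"
          using insert.prems(3)[of \<phi>] cl[of \<phi> y] y(1) by (simp add: b_def r_neg a_minus_def)
        ultimately show ?thesis using s cl[of \<phi> x] x bc
          by (simp add: finsum_closed Pi_def)
      qed
      show "\<chi> \<in> hom E R \<and> \<chi> \<one>\<^bsub>E\<^esub> = \<one>" if "\<chi> \<in> T" for \<chi>
        by (rule insert.prems(1)) (use that in simp)
      show "\<exists>x\<in>carrier E. \<chi> x \<noteq> \<psi> x" if "\<chi> \<in> T" "\<psi> \<in> T" "\<chi> \<noteq> \<psi>" for \<chi> \<psi>
        by (rule insert.prems(2)) (use that in simp_all)
    qed
    moreover have "\<psi> y \<ominus> \<phi> y \<noteq> \<zero>"
      using y cl[of \<psi> y] cl[of \<phi> y] \<psi> by simp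
    ultimately show "a \<psi> = \<zero>"
      using y(1) cl[of \<psi> y] cl[of \<phi> y] \<psi> insert.prems(3)[of \<psi>] unfolding b_def
      by (simp add: integral_iff)
  qed
  have "(\<Oplus>\<psi>\<in>insert \<phi> T. a \<psi> \<otimes> \<psi> \<one>\<^bsub>E\<^esub>) = \<zero>" by (rule insert.prems(4)) simp
  moreover have "(\<Oplus>\<psi>\<in>insert \<phi> T. a \<psi> \<otimes> \<psi> \<one>\<^bsub>E\<^esub>) = a \<phi> \<otimes> \<phi> \<one>\<^bsub>E\<^esub> \<oplus> (\<Oplus>\<psi>\<in>T. a \<psi> \<otimes> \<psi> \<one>\<^bsub>E\<^esub>)"
    using insert.hyps insert.prems(3) cl by (intro finsum_insert) auto
  moreover have "(\<Oplus>\<psi>\<in>T. a \<psi> \<otimes> \<psi> \<one>\<^bsub>E\<^esub>) = (\<Oplus>\<psi>\<in>T. \<zero>)"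
    using rest cl by (intro finsum_cong') auto
  ultimately have "a \<phi> = \<zero>"
    using insert.prems(1)[of \<phi>] insert.prems(3)[of \<phi>] by simp
  with rest show ?case using insert.prems(5) by auto
qed simp

text \<open>The trace \<open>x \<mapsto> \<Sum>s\<in>S. s x\<close> takes values in the fixed field, so \<open>f\<close> and \<open>g\<close>
  agree on it, which is a linear relation with coefficients \<open>1\<close> and \<open>-1\<close> between the
  characters \<open>f \<circ> s\<close> and \<open>g \<circ> s\<close>. By independence two of these must
  coincide, and as \<open>f\<close> and \<open>g\<close> are injective, the only possibility is \<open>f \<circ> s = g \<circ> t\<close>; then \<open>g = f \<circ> s \<circ> t\<^sup>-\<^sup>1\<close>. For an
  extension of the fixed field of \<open>S\<close> this says both that it is normal and that \<open>S\<close> is its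
  whole Galois group.\<close>

lemma (in field) homs_eq_on_fixed_field:
  assumes E: "field E" and S: "subgroup S (BijGroup (carrier E))" "finite S" "S \<subseteq> ring_hom E E"
    and f: "f \<in> ring_hom E R" and g: "g \<in> ring_hom E R"
    and eq: "\<And>x. x \<in> fixed_points S (carrier E) \<Longrightarrow> f x = g x"
  shows "\<exists>s\<in>S. \<forall>x\<in>carrier E. g x = f (s x)"
proof (rule ccontr)
  assume contra: "\<not> ?thesis"
  interpret E: field E by (rule E)
  let ?C = "carrier E"
  have SB: "S \<subseteq> Bij ?C" using subgroup.subset[OF S(1)] by (simp add: BijGroup_def)
  have Sc: "s x \<in> ?C" if "s \<in> S" "x \<in> ?C" for s x
    using that S(3) by (auto simp: ring_hom_def)
  have comp: "compose ?C s t \<in> S" if "s \<in> S" "t \<in> S" for s t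
    using subgroup.m_closed[OF S(1) that] subsetD[OF SB that(1)] subsetD[OF SB that(2)]
    by (simp add: BijGroup_def)
  have inv: "\<exists>t\<in>S. (\<forall>x\<in>?C. s (t x) = x) \<and> (\<forall>x\<in>?C. t (s x) = x)" if s: "s \<in> S" for s
  proof (rule bexI[of _ "restrict (inv_into ?C s) ?C"])
    show "restrict (inv_into ?C s) ?C \<in> S"
      using subgroup.m_inv_closed[OF S(1) s] inv_BijGroup[OF subsetD[OF SB s]] by simp
    have "bij_betw s ?C ?C" using subsetD[OF SB s] by (simp add: Bij_def)
    then show "(\<forall>x\<in>?C. s (restrict (inv_into ?C s) ?C x) = x) \<and>
        (\<forall>x\<in>?C. restrict (inv_into ?C s) ?C (s x) = x)"
      using Sc[OF s] by (auto simp: bij_betw_def f_inv_into_f)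
  qed
  have injh: "inj_on h ?C" if "h \<in> ring_hom E R" for h
    using non_trivial_field_hom_is_inj[OF that E field_axioms] .
  have hc: "h x \<in> carrier R" if "h \<in> ring_hom E R" "x \<in> ?C" for h x
    using that by (auto simp: ring_hom_def)
  have extS: "s = t" if "s \<in> S" "t \<in> S" "\<And>x. x \<in> ?C \<Longrightarrow> s x = t x" for s t
    using that SB by (intro extensionalityI[of s ?C t]) (auto simp: Bij_def)
  have injc: "inj_on (compose ?C t) S" if t: "t \<in> S" for t
  proof (rule inj_onI)
    fix r s assume rs: "r \<in> S" "s \<in> S" "compose ?C t r = compose ?C t s"
    show "r = s"
    proof (rule extS[OF rs(1,2)])
      fix y assume y: "y \<in> ?C"
      have "t (r y) = t (s y)" using fun_cong[OF rs(3), of y] y by (simp add: compose_def)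
      then show "r y = s y" using inv[OF t] Sc rs(1,2) y by metis
    qed
  qed
  have fg: "\<exists>x\<in>?C. f (s x) \<noteq> g (t x)" if st: "s \<in> S" "t \<in> S" for s t
  proof (rule ccontr)
    assume c: "\<not> (\<exists>x\<in>?C. f (s x) \<noteq> g (t x))"
    obtain t' where t': "t' \<in> S" "\<And>x. x \<in> ?C \<Longrightarrow> t (t' x) = x" using inv[OF st(2)] by blast
    have "g x = f (compose ?C s t' x)" if "x \<in> ?C" for x
      using that c Sc[OF t'(1)] t'(2) by (auto simp: compose_def)
    then show False using contra comp[OF st(1) t'(1)] by blast
  qed
  \<comment> \<open>Functions agreeing on the field must be equal for the sums over sets of characters to be
    indexed correctly, so the characters are made extensional.\<close>
  let ?f = "\<lambda>s. restrict (\<lambda>x. f (s x)) ?C" and ?g = "\<lambda>s. restrict (\<lambda>x. g (s x)) ?C"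
  have inj: "inj_on (\<lambda>s. restrict (\<lambda>x. h (s x)) ?C) S" if h: "h \<in> ring_hom E R" for h
  proof (rule inj_onI)
    fix s t assume st: "s \<in> S" "t \<in> S"
      and e: "restrict (\<lambda>x. h (s x)) ?C = restrict (\<lambda>x. h (t x)) ?C"
    show "s = t"
    proof (rule extS[OF st])
      fix x assume x: "x \<in> ?C"
      have "h (s x) = h (t x)" using fun_cong[OF e, of x] x by simp
      then show "s x = t x" using injh[OF h] Sc st x by (auto dest: inj_onD)
    qed
  qed
  have disj: "?f ` S \<inter> ?g ` S = {}"
  proof (rule ccontr)
    assume "?f ` S \<inter> ?g ` S \<noteq> {}"
    then obtain s t where st: "s \<in> S" "t \<in> S" "?f s = ?g t" by auto
    have "f (s x) = g (t x)" if "x \<in> ?C" for x using fun_cong[OF st(3), of x] that by simp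
    then show False using fg[OF st(1,2)] by blast
  qed
  define a where "a \<chi> = (if \<chi> \<in> ?f ` S then \<one> else \<ominus> \<one>)" for \<chi>
  let ?T = "?f ` S \<union> ?g ` S"
  have hom: "restrict (\<lambda>x. h (s x)) ?C \<in> hom E R \<and> restrict (\<lambda>x. h (s x)) ?C \<one>\<^bsub>E\<^esub> = \<one>"
    if "h \<in> ring_hom E R" "s \<in> S" for h s
    using that(1) subsetD[OF S(3) that(2)] Sc[OF that(2)] by (auto simp: ring_hom_def hom_def)
  obtain s where s: "s \<in> S" using subgroup.one_closed[OF S(1)] by blast
  have "a (?f s) = \<zero>"
  proof (rule characters_independent[OF E.monoid_axioms, where T = ?T and a = a and \<chi> = "?f s"])
    show "finite ?T" using S(2) by simp
    show "\<chi> \<in> hom E R \<and> \<chi> \<one>\<^bsub>E\<^esub> = \<one>" if "\<chi> \<in> ?T" for \<chi>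
      using that hom[OF f] hom[OF g] by blast
    show "\<exists>x\<in>?C. \<chi> x \<noteq> \<psi> x" if "\<chi> \<in> ?T" "\<psi> \<in> ?T" "\<chi> \<noteq> \<psi>" for \<chi> \<psi>
    proof (rule ccontr)
      assume "\<not> (\<exists>x\<in>?C. \<chi> x \<noteq> \<psi> x)"
      then have "\<chi> = \<psi>"
        using that(1,2) by (intro extensionalityI[of \<chi> ?C \<psi>]) auto
      with that(3) show False ..
    qed
    show "a \<chi> \<in> carrier R" if "\<chi> \<in> ?T" for \<chi> by (simp add: a_def)
    show "?f s \<in> ?T" using s by auto
    show "(\<Oplus>\<chi>\<in>?T. a \<chi> \<otimes> \<chi> x) = \<zero>" if x: "x \<in> ?C" for x
    proof -
      define tr where "tr = (\<Oplus>\<^bsub>E\<^esub>s\<in>S. s x)"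
      have trC: "tr \<in> ?C" unfolding tr_def using Sc x by (intro E.finsum_closed) auto
      have push: "h (\<Oplus>\<^bsub>E\<^esub>s\<in>S. s x) = (\<Oplus>s\<in>S. h (s x))" if h: "h \<in> ring_hom E R" for h
      proof -
        interpret h: ring_hom_cring E R h
          using h by (unfold_locales) (auto simp: ring_hom_cring_axioms_def)
        show ?thesis using Sc x by (subst h.hom_finsum) (auto simp: comp_def)
      qed
      have "t tr = tr" if t: "t \<in> S" for t
      proof -
        interpret t: ring_hom_cring E E t
          using t S(3) by (unfold_locales) (auto simp: ring_hom_cring_axioms_def)
        have "t tr = (\<Oplus>\<^bsub>E\<^esub>s\<in>S. t (s x))"
          unfolding tr_def using Sc x by (subst t.hom_finsum) (auto simp: comp_def)
        also have "\<dots> = (\<Oplus>\<^bsub>E\<^esub>s\<in>S. (compose ?C t s) x)"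
          using x by (simp add: compose_def)
        also have "\<dots> = (\<Oplus>\<^bsub>E\<^esub>s\<in>compose ?C t ` S. s x)"
        proof (rule E.finsum_reindex[symmetric])
          show "(\<lambda>s. s x) \<in> compose ?C t ` S \<rightarrow> ?C" using Sc x comp[OF t] by auto
          show "inj_on (compose ?C t) S" by (rule injc[OF t])
        qed
        also have "compose ?C t ` S = S"
        proof (rule card_subset_eq[OF S(2)])
          show "compose ?C t ` S \<subseteq> S" using comp[OF t] by auto
          show "card (compose ?C t ` S) = card S" by (rule card_image[OF injc[OF t]])
        qed
        finally show ?thesis by (simp add: tr_def)
      qed
      with trC have "f tr = g tr" by (intro eq) (auto simp: fixed_points_def)
      then have fgs: "(\<Oplus>s\<in>S. f (s x)) = (\<Oplus>s\<in>S. g (s x))"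
        using push[OF f] push[OF g] by (simp add: tr_def)
      have tc: "\<chi> x \<in> carrier R" if "\<chi> \<in> ?T" for \<chi>
        using that x Sc hc[OF f] hc[OF g] by auto
      have "(\<Oplus>\<chi>\<in>?T. a \<chi> \<otimes> \<chi> x) =
          (\<Oplus>\<chi>\<in>?f ` S. a \<chi> \<otimes> \<chi> x) \<oplus> (\<Oplus>\<chi>\<in>?g ` S. a \<chi> \<otimes> \<chi> x)"
        using S(2) disj tc by (intro finsum_Un_disjoint) (auto simp: a_def)
      also have "(\<Oplus>\<chi>\<in>?f ` S. a \<chi> \<otimes> \<chi> x) = (\<Oplus>s\<in>S. a (?f s) \<otimes> ?f s x)"
        using inj[OF f] tc by (intro finsum_reindex) (auto simp: a_def)
      also have "\<dots> = (\<Oplus>s\<in>S. f (s x))"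
        using x Sc hc[OF f] by (intro finsum_cong') (auto simp: a_def)
      also have "(\<Oplus>\<chi>\<in>?g ` S. a \<chi> \<otimes> \<chi> x) = (\<Oplus>s\<in>S. a (?g s) \<otimes> ?g s x)"
        using inj[OF g] tc by (intro finsum_reindex) (auto simp: a_def)
      also have "\<dots> = (\<Oplus>s\<in>S. (\<ominus> \<one>) \<otimes> g (s x))"
      proof (rule finsum_cong'[OF refl])
        show "a (?g s) \<otimes> ?g s x = (\<ominus> \<one>) \<otimes> g (s x)" if s: "s \<in> S" for s
        proof -
          have "?g s \<notin> ?f ` S" using disj s by blast
          then show ?thesis using x by (simp add: a_def)
        qed
      qed (use x Sc hc[OF g] in auto)
      also have "\<dots> = (\<ominus> \<one>) \<otimes> (\<Oplus>s\<in>S. g (s x))"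
        using x Sc hc[OF g] S(2) by (subst finsum_rdistr) auto
      also have "(\<Oplus>s\<in>S. f (s x)) \<oplus> (\<ominus> \<one>) \<otimes> (\<Oplus>s\<in>S. g (s x)) = \<zero>"
      proof -
        have "(\<Oplus>s\<in>S. g (s x)) \<in> carrier R" using x Sc hc[OF g] by (intro finsum_closed) auto
        then show ?thesis unfolding fgs by (simp add: l_minus r_neg)
      qed
      finally show ?thesis .
    qed
  qed
  then show False using s by (simp add: a_def)
qed

section \<open>Normal closures\<close>

lemma factor_through_image:
  assumes R: "ring R" and S: "ring S" and T: "ring T"
    and h: "h \<in> ring_hom R S" and k: "k \<in> ring_hom R T"
    and ker: "\<And>a. a \<in> carrier R \<Longrightarrow> h a = \<zero>\<^bsub>S\<^esub> \<Longrightarrow> k a = \<zero>\<^bsub>T\<^esub>"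
  shows "\<exists>\<psi> \<in> ring_hom (S\<lparr>carrier := h ` carrier R\<rparr>) T. \<forall>a\<in>carrier R. \<psi> (h a) = k a"
proof -
  interpret h: ring_hom_ring R S h by (rule ring_hom_ringI2[OF R S h])
  interpret k: ring_hom_ring R T k by (rule ring_hom_ringI2[OF R T k])
  have eq: "k a = k b" if ab: "a \<in> carrier R" "b \<in> carrier R" "h a = h b" for a b
  proof -
    have "k (a \<ominus>\<^bsub>R\<^esub> b) = \<zero>\<^bsub>T\<^esub>"
      using ab by (intro ker) (simp_all add: a_minus_def h.S.r_neg)
    moreover have "k (a \<ominus>\<^bsub>R\<^esub> b) = k a \<ominus>\<^bsub>T\<^esub> k b"
      using ab by (simp add: a_minus_def)
    ultimately show ?thesis using ab(1,2) by simp
  qed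
  define \<psi> where "\<psi> s = k (SOME a. a \<in> carrier R \<and> h a = s)" for s
  have \<psi>: "\<psi> (h a) = k a" if "a \<in> carrier R" for a
    unfolding \<psi>_def by (rule someI2[of _ a], use that in simp, use eq that in blast)
  have "\<psi> \<in> ring_hom (S\<lparr>carrier := h ` carrier R\<rparr>) T"
  proof (rule ring_hom_memI)
    fix x y assume "x \<in> carrier (S\<lparr>carrier := h ` carrier R\<rparr>)" "y \<in> carrier (S\<lparr>carrier := h ` carrier R\<rparr>)"
    then obtain a b where ab: "a \<in> carrier R" "x = h a" "b \<in> carrier R" "y = h b" by auto
    show "\<psi> x \<in> carrier T" using ab \<psi> by simp
    show "\<psi> (x \<otimes>\<^bsub>S\<lparr>carrier := h ` carrier R\<rparr>\<^esub> y) = \<psi> x \<otimes>\<^bsub>T\<^esub> \<psi> y"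
      using ab \<psi>[of a] \<psi>[of b] \<psi>[of "a \<otimes>\<^bsub>R\<^esub> b"] by simp
    show "\<psi> (x \<oplus>\<^bsub>S\<lparr>carrier := h ` carrier R\<rparr>\<^esub> y) = \<psi> x \<oplus>\<^bsub>T\<^esub> \<psi> y"
      using ab \<psi>[of a] \<psi>[of b] \<psi>[of "a \<oplus>\<^bsub>R\<^esub> b"] by simp
  next
    show "\<psi> \<one>\<^bsub>S\<lparr>carrier := h ` carrier R\<rparr>\<^esub> = \<one>\<^bsub>T\<^esub>"
      using \<psi>[of "\<one>\<^bsub>R\<^esub>"] by simp
  qed
  with \<psi> show ?thesis by blast
qed

lemma ring_hom_subset:
  assumes "h \<in> ring_hom (R\<lparr>carrier := T\<rparr>) S" "T' \<subseteq> T"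
  shows "h \<in> ring_hom (R\<lparr>carrier := T'\<rparr>) S"
  using assms by (simp add: ring_hom_def Pi_iff subset_iff)

text \<open>Evaluation at \<open>y\<close> after applying \<open>\<phi>\<close> to the coefficients. The hom \<open>\<phi>\<close> may have a kernel, so the
  mapped coefficient list need not be normalized; evaluation does not see the difference.\<close>

lemma (in domain) eval_map_is_hom:
  assumes E: "subring E R" and \<phi>: "\<phi> \<in> ring_hom (R\<lparr>carrier := E\<rparr>) R" and y: "y \<in> carrier R"
  shows "(\<lambda>p. eval (map \<phi> p) y) \<in> ring_hom (E[X]) R"
proof -
  interpret E: ring "R\<lparr>carrier := E\<rparr>" by (rule subring_is_ring[OF E])
  interpret \<phi>: ring_hom_ring "R\<lparr>carrier := E\<rparr>" R \<phi>
    by (rule ring_hom_ringI2[OF E.ring_axioms ring_axioms \<phi>])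
  have setE: "set p \<subseteq> E" if "p \<in> carrier (E[X])" for p
    using that by (auto simp: univ_poly_def polynomial_def)
  have setmap: "set (map \<phi> p) \<subseteq> carrier R" if "p \<in> carrier (E[X])" for p
    using \<phi>.hom_closed setE[OF that] by auto
  show ?thesis
  proof (rule ring_hom_memI)
    fix p q assume p: "p \<in> carrier (E[X])" and q: "q \<in> carrier (E[X])"
    show "eval (map \<phi> p) y \<in> carrier R" by (rule eval_in_carrier[OF setmap[OF p] y])
    have mm: "set (map \<phi> (poly_mult p q)) \<subseteq> carrier R" "set (map \<phi> (poly_add p q)) \<subseteq> carrier R"
      using setmap[of "p \<otimes>\<^bsub>E[X]\<^esub> q"] setmap[of "p \<oplus>\<^bsub>E[X]\<^esub> q"] p q
        ring.ring_simprules(5)[OF univ_poly_is_ring[OF E]] ring.ring_simprules(1)[OF univ_poly_is_ring[OF E]]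
      by (auto simp: univ_poly_mult univ_poly_add)
    have "eval (map \<phi> (poly_mult p q)) y = eval (poly_mult (map \<phi> p) (map \<phi> q)) y"
      using \<phi>.poly_mult_hom'[of p q] setE[OF p] setE[OF q] eval_normalize[OF mm(1) y]
      by (simp add: poly_mult_consistent[OF E])
    then show "eval (map \<phi> (p \<otimes>\<^bsub>E[X]\<^esub> q)) y = eval (map \<phi> p) y \<otimes> eval (map \<phi> q) y"
      using eval_poly_mult[OF setmap[OF p] setmap[OF q] y] by (simp add: univ_poly_mult)
    have "eval (map \<phi> (poly_add p q)) y = eval (poly_add (map \<phi> p) (map \<phi> q)) y"
      using \<phi>.poly_add_hom'[of p q] setE[OF p] setE[OF q] eval_normalize[OF mm(2) y]
      by (simp add: poly_add_consistent[OF E])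
    then show "eval (map \<phi> (p \<oplus>\<^bsub>E[X]\<^esub> q)) y = eval (map \<phi> p) y \<oplus> eval (map \<phi> q) y"
      using eval_poly_add[OF setmap[OF p] setmap[OF q] y] by (simp add: univ_poly_add)
  next
    show "eval (map \<phi> \<one>\<^bsub>E[X]\<^esub>) y = \<one>"
      using ring_hom_one[OF \<phi>] y by (simp add: univ_poly_one)
  qed
qed

lemma (in algebraically_closed) exists_root_of_nonconstant:
  assumes p: "p \<in> carrier (poly_ring L)" and deg: "degree p \<ge> 1"
  shows "\<exists>y\<in>carrier L. eval p y = \<zero>"
proof -
  have "roots p \<noteq> {#}"
    using roots_over_carrier[OF p] deg by (auto simp: splitted_def)
  then obtain y where "y \<in># roots p" by auto
  then show ?thesis using roots_mem_iff_is_root[OF p] by (auto simp: is_root_def)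
qed

text \<open>Send \<open>x\<close> to a root \<open>y\<close> of the image under \<open>\<phi>\<close> of its minimal polynomial. Both evaluations
  start at the polynomial ring over \<open>E\<close>, and the kernel of evaluation at \<open>x\<close> is generated by
  the minimal polynomial, so the evaluation at \<open>y\<close> factors through \<open>E(x)\<close>.\<close>

lemma (in algebraically_closed) extend_hom_simple:
  assumes E: "subfield E L" and x: "x \<in> carrier L" and alg: "(algebraic over E) x"
    and \<phi>: "\<phi> \<in> ring_hom (L\<lparr>carrier := E\<rparr>) L"
  shows "\<exists>\<psi> \<in> ring_hom (L\<lparr>carrier := simple_extension E x\<rparr>) L. \<forall>e\<in>E. \<psi> e = \<phi> e"
proof -
  note Er = subfieldE(1)[OF E]
  interpret E: field "L\<lparr>carrier := E\<rparr>" by (rule subfield_iff(2)[OF E])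
  interpret EX: ring "E[X]" by (rule univ_poly_is_ring[OF Er])
  let ?p = "Irr E x"
  note Irr = IrrE[OF E x alg]
  have "map \<phi> ?p \<in> carrier (poly_ring L)"
    using polynomial_hom[OF \<phi> E.field_axioms field_axioms, of ?p] Irr(1)
    by (simp add: univ_poly_consistent[OF Er])
  moreover have "degree (map \<phi> ?p) \<ge> 1"
    using pirreducible_degree[OF E Irr(1,2)] by simp
  ultimately obtain y where y: "y \<in> carrier L" "eval (map \<phi> ?p) y = \<zero>"
    using exists_root_of_nonconstant by blast
  let ?k = "\<lambda>p. eval (map \<phi> p) y" and ?h = "\<lambda>p. eval p x"
  have k: "?k \<in> ring_hom (E[X]) L" by (rule eval_map_is_hom[OF Er \<phi> y(1)])
  have h: "?h \<in> ring_hom (E[X]) L" by (rule eval_is_hom[OF Er x])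
  have "\<exists>\<psi> \<in> ring_hom (L\<lparr>carrier := ?h ` carrier (E[X])\<rparr>) L. \<forall>a\<in>carrier (E[X]). \<psi> (?h a) = ?k a"
  proof (rule factor_through_image[OF EX.ring_axioms ring_axioms ring_axioms h k])
    fix a assume a: "a \<in> carrier (E[X])" "eval a x = \<zero>"
    have "?p divides\<^bsub>E[X]\<^esub> a"
      using Irr_minimal[OF E x alg a] pdivides_iff_shell[OF E Irr(1) a(1)] by simp
    then obtain r where r: "r \<in> carrier (E[X])" "a = ?p \<otimes>\<^bsub>E[X]\<^esub> r" by (auto simp: factor_def)
    have "?k a = ?k ?p \<otimes> ?k r"
      unfolding r(2) by (rule ring_hom_mult[OF k Irr(1) r(1)])
    then show "?k a = \<zero>" using y ring_hom_closed[OF k r(1)] by simp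
  qed
  then obtain \<psi> where \<psi>: "\<psi> \<in> ring_hom (L\<lparr>carrier := simple_extension E x\<rparr>) L"
      "\<And>a. a \<in> carrier (E[X]) \<Longrightarrow> \<psi> (eval a x) = eval (map \<phi> a) y"
    unfolding simple_extension_as_eval_img[OF subringE(1)[OF Er] x] by auto
  have "\<psi> e = \<phi> e" if e: "e \<in> E" for e
  proof (cases "e = \<zero>")
    case True
    interpret \<phi>: ring_hom_ring "L\<lparr>carrier := E\<rparr>" L \<phi>
      by (rule ring_hom_ringI2[OF E.ring_axioms ring_axioms \<phi>])
    show ?thesis using \<psi>(2)[of "[]"] \<phi>.hom_zero True by (simp add: univ_poly_def polynomial_def)
  next
    case False
    have ec: "e \<in> carrier L" "\<phi> e \<in> carrier L"
      using e subringE(1)[OF Er] ring_hom_closed[OF \<phi>] by auto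
    have "[e] \<in> carrier (E[X])" using e False by (auto simp: univ_poly_def polynomial_def)
    from \<psi>(2)[OF this] show ?thesis using ec x y(1) by simp
  qed
  with \<psi>(1) show ?thesis by blast
qed

lemma (in algebraically_closed) extend_hom:
  assumes E: "subfield E L"
    and \<phi>: "\<phi> \<in> ring_hom (L\<lparr>carrier := E\<rparr>) L"
  shows "set xs \<subseteq> carrier L \<Longrightarrow> (\<And>x. x \<in> set xs \<Longrightarrow> (algebraic over E) x) \<Longrightarrow>
    \<exists>\<psi> \<in> ring_hom (L\<lparr>carrier := finite_extension E xs\<rparr>) L. \<forall>e\<in>E. \<psi> e = \<phi> e"
proof (induction xs)
  case Nil
  show ?case using \<phi> by auto
next
  case (Cons x xs)
  have EL: "E \<subseteq> carrier L" by (rule subfieldE(3)[OF E])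
  have sub: "subfield (finite_extension E xs) L"
    by (rule finite_extension_is_subfield[OF E]) (use Cons.prems in auto)
  have incl: "E \<subseteq> finite_extension E xs"
    by (rule finite_extension_incl[OF EL]) (use Cons.prems in auto)
  obtain \<psi> where \<psi>: "\<psi> \<in> ring_hom (L\<lparr>carrier := finite_extension E xs\<rparr>) L" "\<forall>e\<in>E. \<psi> e = \<phi> e"
    using Cons by auto
  have alg: "(algebraic over finite_extension E xs) x"
    by (rule algebraic_mono[OF incl]) (use Cons.prems in auto)
  obtain \<chi> where "\<chi> \<in> ring_hom (L\<lparr>carrier := simple_extension (finite_extension E xs) x\<rparr>) L"
      "\<forall>e\<in>finite_extension E xs. \<chi> e = \<psi> e"
    using extend_hom_simple[OF sub _ alg \<psi>(1)] Cons.prems by auto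
  moreover from this \<psi>(2) incl have "\<forall>e\<in>E. \<chi> e = \<phi> e" by auto
  ultimately show ?case by auto
qed

lemma (in ring) a_inv_subring:
  assumes "subring S R" "z \<in> S"
  shows "\<ominus>\<^bsub>R\<lparr>carrier := S\<rparr>\<^esub> z = \<ominus> z"
  using add.m_inv_consistent[OF subring.axioms(1)[OF assms(1)] assms(2)] by (simp add: a_inv_def)

lemma (in ring) subring_preimage:
  assumes S: "subring S R" and T: "subring T R" and h: "h \<in> ring_hom (R\<lparr>carrier := S\<rparr>) R"
  shows "subring {z \<in> S. h z \<in> T} R"
proof -
  interpret h: ring_hom_ring "R\<lparr>carrier := S\<rparr>" R h
    by (rule ring_hom_ringI2[OF subring_is_ring[OF S] ring_axioms h])
  have neg: "\<ominus>\<^bsub>R\<lparr>carrier := S\<rparr>\<^esub> z = \<ominus> z" if "z \<in> S" for z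
    using that S by (simp add: a_inv_subring)
  have "h (\<ominus> z) = \<ominus> h z" if "z \<in> S" for z
    using that h.hom_a_inv[of z] neg[OF that] by simp
  then show ?thesis
    using subringE[OF S] subringE[OF T] ring_hom_one[OF h] ring_hom_mult[OF h] ring_hom_add[OF h]
    by (intro subringI) auto
qed

lemma (in ring) subring_equalizer:
  assumes S: "subring S R"
    and h: "h \<in> ring_hom (R\<lparr>carrier := S\<rparr>) R" and k: "k \<in> ring_hom (R\<lparr>carrier := S\<rparr>) R"
  shows "subring {z \<in> S. h z = k z} R"
proof -
  have neg: "f (\<ominus> z) = \<ominus> f z" if f: "f \<in> ring_hom (R\<lparr>carrier := S\<rparr>) R" and z: "z \<in> S" for f z
  proof -
    interpret f: ring_hom_ring "R\<lparr>carrier := S\<rparr>" R f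
      by (rule ring_hom_ringI2[OF subring_is_ring[OF S] ring_axioms f])
    show ?thesis using z f.hom_a_inv[of z] S by (simp add: a_inv_subring)
  qed
  show ?thesis
    using subringE[OF S] neg[OF h] neg[OF k] ring_hom_one[OF h] ring_hom_mult[OF h] ring_hom_add[OF h]
      ring_hom_one[OF k] ring_hom_mult[OF k] ring_hom_add[OF k]
    by (intro subringI) auto
qed

text \<open>Adjoin to the image of \<open>F\<close> in an algebraic closure all roots of the minimal polynomials of a
  spanning set of the extension. The result is generated by a finite set \<open>ws\<close> which every
  \<open>F\<close>-homomorphism into the closure permutes. Hence such a homomorphism is determined by a
  permutation of \<open>ws\<close>, which makes the group finite, and maps \<open>L\<close> onto itself. The last clause
  expresses normality: embeddings of intermediate fields over \<open>F\<close> extend to automorphisms.\<close>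

lemma (in field) exists_normal_closure:
  assumes F: "subfield F R" and fd: "finite_dimension F (carrier R)"
  shows "\<exists>(L :: (('a list \<times> nat) multiset \<Rightarrow> 'a) ring) \<iota>.
    field L \<and> \<iota> \<in> ring_hom R L \<and> finite (carrier (field_aut_group L (\<iota> ` F) (carrier L))) \<and>
    (\<forall>E g. subfield E R \<and> F \<subseteq> E \<and> g \<in> ring_hom (R\<lparr>carrier := E\<rparr>) L \<and> (\<forall>x\<in>F. g x = \<iota> x) \<longrightarrow>
      (\<exists>\<gamma>\<in>carrier (field_aut_group L (\<iota> ` F) (carrier L)). \<forall>x\<in>E. \<gamma> (\<iota> x) = g x))"
proof -
  obtain C :: "(('a list \<times> nat) multiset \<Rightarrow> 'a) ring"
    where "algebraic_closure C (indexed_const ` carrier R)" and hom: "indexed_const \<in> ring_hom R C"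
    by (rule exists_closure)
  then interpret C: algebraic_closure C "indexed_const ` carrier R" by simp
  define \<iota> :: "'a \<Rightarrow> ('a list \<times> nat) multiset \<Rightarrow> 'a" where "\<iota> = indexed_const"
  interpret \<iota>: ring_hom_ring R C \<iota>
    unfolding \<iota>_def by (rule ring_hom_ringI2[OF ring_axioms C.ring_axioms hom])
  have \<iota>_inj: "inj_on \<iota> (carrier R)"
    by (rule non_trivial_field_hom_is_inj[OF \<iota>.homh field_axioms C.field_axioms])
  have FR: "F \<subseteq> carrier R" by (rule subfieldE(3)[OF F])
  let ?K = "\<iota> ` F"
  have K: "subfield ?K C" by (rule \<iota>.img_is_subfield(2)[OF F C.one_not_zero])
  note Kr = subfieldE(1)[OF K]
  obtain xs where xs: "set xs \<subseteq> carrier R" "Span F xs = carrier R"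
    using exists_base[OF F] fd unfolding finite_dimension_def by blast
  let ?W = "\<Union>x\<in>set xs. {z. C.is_root (C.Irr ?K (\<iota> x)) z}"
  have alg_x: "(C.algebraic over ?K) (\<iota> x)" if "x \<in> carrier R" for x
    using algebraic_hom[OF \<iota>.homh field_axioms C.field_axioms F that]
      finite_dimension_imp_algebraic[OF F carrier_is_subring fd that] by blast
  have Irr: "C.Irr ?K (\<iota> x) \<in> carrier (?K[X]\<^bsub>C\<^esub>)" "C.Irr ?K (\<iota> x) \<noteq> []"
      "C.eval (C.Irr ?K (\<iota> x)) (\<iota> x) = \<zero>\<^bsub>C\<^esub>" if "x \<in> set xs" for x
  proof -
    have x: "x \<in> carrier R" using that xs(1) by blast
    note I = C.IrrE[OF K \<iota>.hom_closed[OF x] alg_x[OF x]]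
    show "C.Irr ?K (\<iota> x) \<in> carrier (?K[X]\<^bsub>C\<^esub>)" "C.eval (C.Irr ?K (\<iota> x)) (\<iota> x) = \<zero>\<^bsub>C\<^esub>"
      using I by auto
    show "C.Irr ?K (\<iota> x) \<noteq> []" by (rule C.pirreducibleE(1)[OF Kr I(1,2)])
  qed
  have finW: "finite ?W"
    using Irr(1) C.finite_number_of_roots C.carrier_polynomial_shell[OF Kr] by blast
  then obtain ws where ws: "set ws = ?W" by (meson finite_list)
  have WC: "set ws \<subseteq> carrier C" unfolding ws by (auto simp: C.is_root_def)
  have algW: "(C.algebraic over ?K) w" if w: "w \<in> set ws" for w
    using w Irr C.algebraicI[of _ ?K w] unfolding ws by (auto simp: C.is_root_def)
  define \<Omega> where "\<Omega> = C.finite_extension ?K ws"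
  have \<Omega>: "subfield \<Omega> C" unfolding \<Omega>_def by (rule C.finite_extension_is_subfield[OF K WC algW])
  note \<Omega>r = subfieldE(1)[OF \<Omega>]
  have \<Omega>C: "\<Omega> \<subseteq> carrier C" by (rule subringE(1)[OF \<Omega>r])
  have K\<Omega>: "?K \<subseteq> \<Omega>" unfolding \<Omega>_def by (rule C.finite_extension_incl[OF subfieldE(3)[OF K] WC])
  have W\<Omega>: "set ws \<subseteq> \<Omega>" unfolding \<Omega>_def by (rule C.finite_extension_mem[OF Kr WC])
  have \<Omega>min: "\<Omega> \<subseteq> T" if "subring T C" "?K \<subseteq> T" "set ws \<subseteq> T" for T
    unfolding \<Omega>_def by (rule C.finite_extension_subring_incl[OF that])
  have xW: "\<iota> x \<in> set ws" if "x \<in> set xs" for x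
    unfolding ws using that Irr[OF that] xs(1) by (auto simp: C.is_root_def)
  have \<iota>\<Omega>: "\<iota> x \<in> \<Omega>" if x: "x \<in> carrier R" for x
  proof -
    have "subalgebra ?K \<Omega> C"
      using \<Omega>r subringE[OF \<Omega>r] K\<Omega>
      by (auto intro!: subalgebra.intro subalgebra_axioms.intro subring.axioms(1))
    then have "C.Span ?K (map \<iota> xs) \<subseteq> \<Omega>"
      by (intro C.subalgebra_Span_incl[OF K]) (use xW W\<Omega> in auto)
    then show ?thesis using \<iota>.Span_hom[OF FR xs(1)] xs(2) x by auto
  qed
  define L where "L = C\<lparr>carrier := \<Omega>\<rparr>"
  have Lc: "carrier L = \<Omega>" by (simp add: L_def)
  let ?\<Gamma> = "field_aut_group L (\<iota> ` F) (carrier L)"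
  have LL: "L\<lparr>carrier := carrier L\<rparr> = C\<lparr>carrier := \<Omega>\<rparr>" by (simp add: L_def)
  have L: "field L" unfolding L_def by (rule C.subfield_iff(2)[OF \<Omega>])
  have toC: "g \<in> ring_hom Q C" if "g \<in> ring_hom Q L" for g and Q :: "('q, 'r) ring_scheme"
    using that \<Omega>C by (auto simp: ring_hom_def L_def)
  have roots_map: "\<psi> w \<in> set ws"
    if \<psi>: "\<psi> \<in> ring_hom (C\<lparr>carrier := \<Omega>\<rparr>) C" "\<And>a. a \<in> ?K \<Longrightarrow> \<psi> a = a" and w: "w \<in> set ws" for \<psi> w
  proof -
    obtain x where x: "x \<in> set xs" "C.is_root (C.Irr ?K (\<iota> x)) w" using w ws by auto
    let ?p = "C.Irr ?K (\<iota> x)"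
    interpret \<psi>: ring_hom_ring "C\<lparr>carrier := \<Omega>\<rparr>" C \<psi>
      by (rule ring_hom_ringI2[OF C.subring_is_ring[OF \<Omega>r] C.ring_axioms \<psi>(1)])
    have pK: "set ?p \<subseteq> ?K" using Irr(1)[OF x(1)] by (auto simp: univ_poly_def polynomial_def)
    then have "map \<psi> ?p = ?p" using \<psi>(2) by (intro map_idI) auto
    then have "C.eval ?p (\<psi> w) = \<psi> (C.eval ?p w)"
      using \<psi>.eval_hom'[of w ?p] pK K\<Omega> w W\<Omega> by (auto simp: C.eval_consistent[OF \<Omega>r])
    also have "\<dots> = \<zero>\<^bsub>C\<^esub>" using x(2) \<psi>.hom_zero by (simp add: C.is_root_def)
    finally have "C.is_root ?p (\<psi> w)"
      using x(2) \<psi>.hom_closed[of w] w W\<Omega> by (auto simp: C.is_root_def)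
    then show ?thesis using ws x(1) by auto
  qed
  have fin: "finite (carrier ?\<Gamma>)"
  proof (rule inj_on_finite[of "\<lambda>\<gamma>. restrict \<gamma> (set ws)" _ "set ws \<rightarrow>\<^sub>E set ws"])
    have D: "\<gamma> \<in> ring_hom (C\<lparr>carrier := \<Omega>\<rparr>) C" "\<And>a. a \<in> ?K \<Longrightarrow> \<gamma> a = a" "\<gamma> \<in> extensional \<Omega>"
      if "\<gamma> \<in> carrier ?\<Gamma>" for \<gamma>
      using field_aut_groupD[OF that] toC[of \<gamma> L] unfolding LL by (auto simp: L_def)
    show "(\<lambda>\<gamma>. restrict \<gamma> (set ws)) ` carrier ?\<Gamma> \<subseteq> set ws \<rightarrow>\<^sub>E set ws"
    proof (rule image_subsetI)
      fix \<gamma> assume m: "\<gamma> \<in> carrier ?\<Gamma>"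
      show "restrict \<gamma> (set ws) \<in> set ws \<rightarrow>\<^sub>E set ws"
        using roots_map[OF D(1,2)[OF m]] by simp
    qed
    show "inj_on (\<lambda>\<gamma>. restrict \<gamma> (set ws)) (carrier ?\<Gamma>)"
    proof (rule inj_onI)
      fix \<gamma> \<delta> assume m: "\<gamma> \<in> carrier ?\<Gamma>" "\<delta> \<in> carrier ?\<Gamma>"
        and e: "restrict \<gamma> (set ws) = restrict \<delta> (set ws)"
      have "\<gamma> w = \<delta> w" if "w \<in> set ws" for w using fun_cong[OF e, of w] that by simp
      then have "\<Omega> \<subseteq> {z \<in> \<Omega>. \<gamma> z = \<delta> z}"
        using D(2)[OF m(1)] D(2)[OF m(2)] K\<Omega> W\<Omega>
        by (intro \<Omega>min C.subring_equalizer[OF \<Omega>r D(1)[OF m(1)] D(1)[OF m(2)]]) auto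
      then show "\<gamma> = \<delta>"
        using D(3)[OF m(1)] D(3)[OF m(2)] by (intro extensionalityI[of \<gamma> \<Omega> \<delta>]) auto
    qed
    show "finite (set ws \<rightarrow>\<^sub>E set ws)" by (intro finite_PiE) auto
  qed
  have ext: "\<exists>\<gamma>\<in>carrier ?\<Gamma>. \<forall>x\<in>E. \<gamma> (\<iota> x) = g x"
    if E: "subfield E R" "F \<subseteq> E" and g: "g \<in> ring_hom (R\<lparr>carrier := E\<rparr>) L" "\<forall>x\<in>F. g x = \<iota> x" for E g
  proof -
    have ER: "E \<subseteq> carrier R" by (rule subfieldE(3)[OF E(1)])
    have iE: "subfield (\<iota> ` E) C" by (rule \<iota>.img_is_subfield(2)[OF E(1) C.one_not_zero])
    \<comment> \<open>The embedding to be extended, transported to the image of \<open>E\<close> in the closure.\<close>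
    define \<phi> where "\<phi> z = g (inv_into E \<iota> z)" for z
    have \<phi>: "\<phi> (\<iota> x) = g x" if "x \<in> E" for x
      using that \<iota>_inj ER by (simp add: \<phi>_def inv_into_f_f inj_on_subset)
    note Es = subringE[OF subfieldE(1)[OF E(1)]]
    have gC: "g \<in> ring_hom (R\<lparr>carrier := E\<rparr>) C" by (rule toC[OF g(1)])
    have "\<phi> \<in> ring_hom (C\<lparr>carrier := \<iota> ` E\<rparr>) C"
    proof (rule ring_hom_memI)
      fix x y assume "x \<in> carrier (C\<lparr>carrier := \<iota> ` E\<rparr>)" "y \<in> carrier (C\<lparr>carrier := \<iota> ` E\<rparr>)"
      then obtain a b where ab: "a \<in> E" "x = \<iota> a" "b \<in> E" "y = \<iota> b" by auto
      then have abR: "a \<in> carrier R" "b \<in> carrier R" using ER by auto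
      show "\<phi> x \<in> carrier C" using ab \<phi> ring_hom_closed[OF gC] by simp
      show "\<phi> (x \<otimes>\<^bsub>C\<lparr>carrier := \<iota> ` E\<rparr>\<^esub> y) = \<phi> x \<otimes>\<^bsub>C\<^esub> \<phi> y"
        using ab abR \<phi>[of a] \<phi>[of b] \<phi>[of "a \<otimes> b"] Es(6)[of a b] ring_hom_mult[OF gC, of a b]
        by simp
      show "\<phi> (x \<oplus>\<^bsub>C\<lparr>carrier := \<iota> ` E\<rparr>\<^esub> y) = \<phi> x \<oplus>\<^bsub>C\<^esub> \<phi> y"
        using ab abR \<phi>[of a] \<phi>[of b] \<phi>[of "a \<oplus> b"] Es(7)[of a b] ring_hom_add[OF gC, of a b]
        by simp
    next
      show "\<phi> \<one>\<^bsub>C\<lparr>carrier := \<iota> ` E\<rparr>\<^esub> = \<one>\<^bsub>C\<^esub>"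
        using \<phi>[of \<one>] Es(3) ring_hom_one[OF gC] \<iota>.hom_one by simp
    qed
    then have "\<exists>\<psi>\<in>ring_hom (C\<lparr>carrier := C.finite_extension (\<iota> ` E) ws\<rparr>) C. \<forall>e\<in>\<iota> ` E. \<psi> e = \<phi> e"
      using C.algebraic_mono[of ?K "\<iota> ` E"] algW E(2) by (intro C.extend_hom[OF iE _ WC]) auto
    then obtain \<psi> where \<psi>: "\<psi> \<in> ring_hom (C\<lparr>carrier := C.finite_extension (\<iota> ` E) ws\<rparr>) C"
        "\<And>x. x \<in> E \<Longrightarrow> \<psi> (\<iota> x) = g x"
      using \<phi> by auto
    have "\<Omega> \<subseteq> C.finite_extension (\<iota> ` E) ws"
      unfolding \<Omega>_def using E(2) by (intro C.mono_finite_extension) auto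
    then have \<psi>\<Omega>: "\<psi> \<in> ring_hom (C\<lparr>carrier := \<Omega>\<rparr>) C" by (rule ring_hom_subset[OF \<psi>(1)])
    have \<psi>K: "\<psi> a = a" if "a \<in> ?K" for a using that \<psi>(2) E(2) g(2) by auto
    interpret \<psi>: ring_hom_ring "C\<lparr>carrier := \<Omega>\<rparr>" C \<psi>
      by (rule ring_hom_ringI2[OF C.subring_is_ring[OF \<Omega>r] C.ring_axioms \<psi>\<Omega>])
    have inj: "inj_on \<psi> \<Omega>"
      using non_trivial_field_hom_is_inj[OF \<psi>\<Omega> C.subfield_iff(2)[OF \<Omega>] C.field_axioms] by simp
    have \<psi>W: "\<psi> ` set ws = set ws"
      using roots_map[OF \<psi>\<Omega> \<psi>K] inj_on_subset[OF inj W\<Omega>]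
      by (intro endo_inj_surj) auto
    have "\<Omega> \<subseteq> {z \<in> \<Omega>. \<psi> z \<in> \<Omega>}"
      using K\<Omega> W\<Omega> \<psi>K roots_map[OF \<psi>\<Omega> \<psi>K]
      by (intro \<Omega>min C.subring_preimage[OF \<Omega>r \<Omega>r \<psi>\<Omega>]) auto
    moreover have "\<Omega> \<subseteq> \<psi> ` \<Omega>"
    proof (rule \<Omega>min)
      show "subring (\<psi> ` \<Omega>) C"
        using \<psi>.img_is_subring[of \<Omega>] ring.carrier_is_subring[OF C.subring_is_ring[OF \<Omega>r]] by simp
      show "?K \<subseteq> \<psi> ` \<Omega>" using \<psi>K K\<Omega> by force
      show "set ws \<subseteq> \<psi> ` \<Omega>" using \<psi>W W\<Omega> by blast
    qed
    ultimately have im: "\<psi> ` \<Omega> = \<Omega>" by auto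
    have "restrict \<psi> \<Omega> \<in> carrier ?\<Gamma>"
    proof (rule field_aut_groupI)
      show "bij_betw (restrict \<psi> \<Omega>) (carrier L) (carrier L)"
        using inj im by (simp add: Lc bij_betw_def)
      show "restrict \<psi> \<Omega> \<in> ring_hom (L\<lparr>carrier := carrier L\<rparr>) (L\<lparr>carrier := carrier L\<rparr>)"
        unfolding LL using subringE[OF \<Omega>r] im \<psi>\<Omega> by (auto simp: ring_hom_def)
      show "restrict \<psi> \<Omega> x = x" if "x \<in> ?K" for x using that K\<Omega> \<psi>K by auto
    qed (simp add: Lc)
    then show ?thesis using \<psi>(2) \<iota>\<Omega> ER by (intro bexI[of _ "restrict \<psi> \<Omega>"]) auto
  qed
  have "\<iota> \<in> ring_hom R L" using \<iota>.homh \<iota>\<Omega> by (auto simp: ring_hom_def L_def)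
  with L fin ext show ?thesis by blast
qed

lemma (in ring) finite_dimension_in_subring:
  assumes K: "subfield K R" and M: "subring M R" "K \<subseteq> M" and dim: "dimension n K M"
  shows "ring.finite_dimension (R\<lparr>carrier := M\<rparr>) K M"
proof -
  interpret M: ring "R\<lparr>carrier := M\<rparr>" by (rule subring_is_ring[OF M(1)])
  obtain Vs where Vs: "set Vs \<subseteq> carrier R" "Span K Vs = M"
    using exists_base[OF K dim] by blast
  have "subfield K (R\<lparr>carrier := M\<rparr>)"
    using M.subfield_iff(1)[of K] subfield_iff(2)[OF K] M(2) by simp
  then have "M.finite_dimension K (M.Span K Vs)"
    using Span_base_incl[OF K Vs(1)] Vs(2) by (intro M.Span_finite_dimension) auto
  then show ?thesis unfolding Span_consistent[OF M(1)] Vs(2) .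
qed

section \<open>Centres of simple rings\<close>

lemma funpow_ring_iso:
  assumes "t \<in> ring_iso R R"
  shows "t ^^ j \<in> ring_iso R R"
proof (induction j)
  case (Suc j)
  have "t \<circ> t ^^ j \<in> ring_hom R R"
    using ring_hom_trans[of "t ^^ j" R R t R] Suc assms by (simp add: ring_iso_def)
  moreover have "bij_betw (t \<circ> t ^^ j) (carrier R) (carrier R)"
    using Suc assms by (auto simp: ring_iso_def intro: bij_betw_trans)
  ultimately show ?case by (simp add: ring_iso_def comp_def)
qed (auto simp: ring_iso_def ring_hom_def bij_betw_def)

lemma field_simple_ring: "field R \<Longrightarrow> simple_ring R"
  unfolding simple_ring_def
  using field.all_ideals[of R] field.is_ring[of R] domain.one_not_zero[OF field.axioms(1), of R]
  by auto

text \<open>For \<open>z\<close> central and non-zero, \<open>zR\<close> is a two-sided ideal, so \<open>z\<close> is invertible, and the inverse of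
  a central element is central.\<close>

lemma (in ring) field_ring_center:
  assumes "simple_ring R"
  shows "field (R\<lparr>carrier := ring_center R\<rparr>)"
proof -
  let ?Z = "ring_center R"
  have ZC: "?Z \<subseteq> carrier R" by (auto simp: ring_center_def)
  have comm: "z \<otimes> x = x \<otimes> z" if "z \<in> ?Z" "x \<in> carrier R" for z x
    using that by (auto simp: ring_center_def)
  have sub: "subring ?Z R"
  proof (rule subringI)
    show "?Z \<subseteq> carrier R" by (rule ZC)
    show "\<one> \<in> ?Z" by (auto simp: ring_center_def)
    show "\<ominus> z \<in> ?Z" if "z \<in> ?Z" for z
      using that by (auto simp: ring_center_def l_minus r_minus)
    fix z w assume zw: "z \<in> ?Z" "w \<in> ?Z"
    then show "z \<oplus> w \<in> ?Z" by (auto simp: ring_center_def l_distr r_distr)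
    have c: "z \<in> carrier R" "w \<in> carrier R" using zw ZC by auto
    have "z \<otimes> w \<otimes> x = x \<otimes> (z \<otimes> w)" if x: "x \<in> carrier R" for x
    proof -
      have "z \<otimes> w \<otimes> x = z \<otimes> (x \<otimes> w)" using c x comm[OF zw(2) x] by (simp add: m_assoc)
      also have "\<dots> = x \<otimes> z \<otimes> w" using c x comm[OF zw(1) x] by (simp add: m_assoc[symmetric])
      finally show ?thesis using c x by (simp add: m_assoc)
    qed
    then show "z \<otimes> w \<in> ?Z" using c by (auto simp: ring_center_def)
  qed
  interpret Z: ring "R\<lparr>carrier := ?Z\<rparr>" by (rule subring_is_ring[OF sub])
  have cring: "cring (R\<lparr>carrier := ?Z\<rparr>)"
    by (unfold_locales) (use comm ZC in auto)
  show ?thesis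
  proof (rule cring.cring_fieldI2[OF cring])
    show "\<zero>\<^bsub>R\<lparr>carrier := ?Z\<rparr>\<^esub> \<noteq> \<one>\<^bsub>R\<lparr>carrier := ?Z\<rparr>\<^esub>"
      using assms by (auto simp: simple_ring_def)
    fix z assume "z \<in> carrier (R\<lparr>carrier := ?Z\<rparr>)" and nz: "z \<noteq> \<zero>\<^bsub>R\<lparr>carrier := ?Z\<rparr>\<^esub>"
    then have z: "z \<in> ?Z" "z \<in> carrier R" using ZC by auto
    let ?I = "{z \<otimes> x | x. x \<in> carrier R}"
    have "ideal ?I R"
    proof (rule idealI[OF ring_axioms])
      show "subgroup ?I (add_monoid R)"
      proof (rule add.subgroupI)
        show "?I \<subseteq> carrier R" "?I \<noteq> {}" using z by auto
        fix a b assume "a \<in> ?I" "b \<in> ?I"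
        then obtain x y where xy: "x \<in> carrier R" "a = z \<otimes> x" "y \<in> carrier R" "b = z \<otimes> y" by auto
        have "\<ominus> a = z \<otimes> (\<ominus> x)" "a \<oplus> b = z \<otimes> (x \<oplus> y)"
          using xy z by (auto simp: r_minus r_distr)
        then show "\<ominus> a \<in> ?I" "a \<oplus> b \<in> ?I" using xy by blast+
      qed
      fix a r assume "a \<in> ?I" and r: "r \<in> carrier R"
      then obtain x where x: "x \<in> carrier R" "a = z \<otimes> x" by auto
      have "r \<otimes> a = z \<otimes> (r \<otimes> x)" using x r z comm[OF z(1) r] by (simp add: m_assoc[symmetric])
      moreover have "a \<otimes> r = z \<otimes> (x \<otimes> r)" using x r z by (simp add: m_assoc)
      ultimately show "r \<otimes> a \<in> ?I" "a \<otimes> r \<in> ?I" using x r by auto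
    qed
    then have "?I = {\<zero>} \<or> ?I = carrier R" using assms by (simp add: simple_ring_def)
    moreover have "z \<in> ?I" using z by (auto intro!: exI[of _ \<one>])
    ultimately have "\<one> \<in> ?I" using nz by auto
    then obtain x where x: "x \<in> carrier R" "z \<otimes> x = \<one>" by auto
    have "x \<otimes> y = y \<otimes> x" if y: "y \<in> carrier R" for y
    proof -
      have "x \<otimes> y = x \<otimes> y \<otimes> (z \<otimes> x)" using x y by simp
      also have "\<dots> = x \<otimes> (y \<otimes> z) \<otimes> x" using x y z by (simp add: m_assoc)
      also have "\<dots> = x \<otimes> (z \<otimes> y) \<otimes> x" using comm[OF z(1) y] by simp
      also have "\<dots> = (x \<otimes> z) \<otimes> y \<otimes> x" using x(1) y z by (simp add: m_assoc)
      also have "x \<otimes> z = \<one>" using comm[OF z(1) x(1)] x(2) by simp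
      finally show ?thesis using x y by simp
    qed
    then have "x \<in> ?Z" using x by (auto simp: ring_center_def)
    then show "\<exists>b\<in>carrier (R\<lparr>carrier := ?Z\<rparr>). z \<otimes>\<^bsub>R\<lparr>carrier := ?Z\<rparr>\<^esub> b = \<one>\<^bsub>R\<lparr>carrier := ?Z\<rparr>\<^esub>"
      using x by auto
  qed
qed

lemma (in ring) ring_iso_center:
  assumes t: "t \<in> ring_iso R R"
  shows "t \<in> ring_iso (R\<lparr>carrier := ring_center R\<rparr>) (R\<lparr>carrier := ring_center R\<rparr>)"
proof -
  let ?Z = "ring_center R"
  have hom: "t \<in> ring_hom R R" and inj: "inj_on t (carrier R)" and im: "t ` carrier R = carrier R"
    using t by (auto simp: ring_iso_def bij_betw_def)
  have ZC: "?Z \<subseteq> carrier R" by (auto simp: ring_center_def)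
  have tZ: "t z \<in> ?Z" if z: "z \<in> ?Z" for z
  proof -
    have "t z \<otimes> x = x \<otimes> t z" if "x \<in> carrier R" for x
    proof -
      have "x \<in> t ` carrier R" unfolding im by (rule that)
      then obtain y where y: "y \<in> carrier R" "x = t y" by blast
      have zc: "z \<in> carrier R" using z ZC by (rule rev_subsetD)
      have e: "z \<otimes> y = y \<otimes> z" using z y(1) unfolding ring_center_def by blast
      have "t z \<otimes> x = t (z \<otimes> y)" unfolding y(2) by (rule ring_hom_mult[OF hom zc y(1), symmetric])
      also have "\<dots> = x \<otimes> t z" unfolding y(2) e by (rule ring_hom_mult[OF hom y(1) zc])
      finally show ?thesis .
    qed
    moreover have "t z \<in> carrier R" using z ZC by (intro ring_hom_closed[OF hom]) auto
    ultimately show ?thesis by (simp add: ring_center_def)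
  qed
  have "w \<in> t ` ?Z" if w: "w \<in> ?Z" for w
  proof -
    have "w \<in> t ` carrier R" unfolding im using w ZC by blast
    then obtain z where z: "z \<in> carrier R" "w = t z" by blast
    have "z \<otimes> x = x \<otimes> z"
      if x: "x \<in> carrier R" for x
    proof (rule inj_onD[OF inj])
      have "t x \<in> carrier R" by (rule ring_hom_closed[OF hom x])
      then show "t (z \<otimes> x) = t (x \<otimes> z)"
        using w x z ring_hom_mult[OF hom] by (simp add: ring_center_def)
    qed (use x z in simp_all)
    then show ?thesis using z by (auto simp: ring_center_def)
  qed
  with tZ have "t ` ?Z = ?Z" by blast
  moreover have "t \<in> ring_hom (R\<lparr>carrier := ?Z\<rparr>) (R\<lparr>carrier := ?Z\<rparr>)"
    using tZ ZC hom by (simp add: ring_hom_def Pi_iff subset_iff)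
  ultimately show ?thesis
    using inj_on_subset[OF inj ZC] by (simp add: ring_iso_def bij_betw_def)
qed

section \<open>Quotients of twisted polynomial rings\<close>

text \<open>One step of the chain, with \<open>R\<close> in the role of \<open>A\<^sub>i\<close>. For general \<open>c\<close> the quotient is only a
  nonassociative ring, which is why the results below speak of its operations directly.\<close>

locale cyclic_skew_quotient = ring R for R (structure) +
  fixes \<tau> :: "'a \<Rightarrow> 'a" and q :: nat and c :: 'a
  assumes simple: "simple_ring R"
    and aut: "\<tau> \<in> ring_iso R R"
    and order: "has_inner_order R \<tau> q" and q2: "2 \<le> q"
    and c_unit: "c \<in> Units R" and c_fixed: "\<tau> c = c"
begin

lemma one_neq_zero: "\<one> \<noteq> \<zero>" using simple by (simp add: simple_ring_def)

lemma c_closed: "c \<in> carrier R" using c_unit by blast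

lemma pow_bij: "bij_betw (\<tau> ^^ i) (carrier R) (carrier R)"
  and pow_hom: "\<tau> ^^ i \<in> ring_hom R R"
  using funpow_ring_iso[OF aut, of i] by (auto simp: ring_iso_def)

lemma pow_closed [simp, intro]: "x \<in> carrier R \<Longrightarrow> (\<tau> ^^ i) x \<in> carrier R"
  using pow_hom by (rule ring_hom_closed)

lemma pow_simps [simp]:
  "(\<tau> ^^ i) \<one> = \<one>" "(\<tau> ^^ i) \<zero> = \<zero>"
  "x \<in> carrier R \<Longrightarrow> y \<in> carrier R \<Longrightarrow> (\<tau> ^^ i) (x \<otimes> y) = (\<tau> ^^ i) x \<otimes> (\<tau> ^^ i) y"
  "x \<in> carrier R \<Longrightarrow> y \<in> carrier R \<Longrightarrow> (\<tau> ^^ i) (x \<oplus> y) = (\<tau> ^^ i) x \<oplus> (\<tau> ^^ i) y"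
  "x \<in> carrier R \<Longrightarrow> (\<tau> ^^ i) (\<ominus> x) = \<ominus> (\<tau> ^^ i) x"
  "(\<tau> ^^ i) c = c"
proof -
  interpret p: ring_hom_ring R R "\<tau> ^^ i"
    by (rule ring_hom_ringI2[OF ring_axioms ring_axioms pow_hom])
  show "(\<tau> ^^ i) \<one> = \<one>" "(\<tau> ^^ i) \<zero> = \<zero>"
    "x \<in> carrier R \<Longrightarrow> y \<in> carrier R \<Longrightarrow> (\<tau> ^^ i) (x \<otimes> y) = (\<tau> ^^ i) x \<otimes> (\<tau> ^^ i) y"
    "x \<in> carrier R \<Longrightarrow> y \<in> carrier R \<Longrightarrow> (\<tau> ^^ i) (x \<oplus> y) = (\<tau> ^^ i) x \<oplus> (\<tau> ^^ i) y"
    "x \<in> carrier R \<Longrightarrow> (\<tau> ^^ i) (\<ominus> x) = \<ominus> (\<tau> ^^ i) x"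
    by auto
  show "(\<tau> ^^ i) c = c" by (induction i) (auto simp: c_fixed)
qed

lemma pow_surj: "x \<in> carrier R \<Longrightarrow> \<exists>b\<in>carrier R. (\<tau> ^^ i) b = x"
  using pow_bij[of i] unfolding bij_betw_def by (metis imageE)

definition monomial :: "'a \<Rightarrow> nat \<Rightarrow> nat \<Rightarrow> 'a"
  where "monomial a j = (\<lambda>n. if n = j then a else \<zero>)"

text \<open>The product of the twisted polynomial ring, for arbitrary coefficient sequences.\<close>

definition skew_prod :: "(nat \<Rightarrow> 'a) \<Rightarrow> (nat \<Rightarrow> 'a) \<Rightarrow> nat \<Rightarrow> 'a"
  where "skew_prod f g = (\<lambda>n. \<Oplus>i \<in> {..n}. f i \<otimes> (\<tau> ^^ i) (g (n - i)))"

lemma monomial_up: "a \<in> carrier R \<Longrightarrow> monomial a j \<in> up R"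
  by (auto simp: monomial_def up_def)

lemma const_poly_monomial: "const_poly R a = monomial a 0"
  by (simp add: const_poly_def monomial_def)

lemma skew_prod_closed:
  assumes "\<And>n. f n \<in> carrier R" "\<And>n. g n \<in> carrier R"
  shows "skew_prod f g n \<in> carrier R"
  unfolding skew_prod_def using assms by (intro finsum_closed) auto

lemma skew_prod_monomial_right:
  assumes f: "\<And>n. f n \<in> carrier R" and b: "b \<in> carrier R"
  shows "skew_prod f (monomial b j) n = (if j \<le> n then f (n - j) \<otimes> (\<tau> ^^ (n - j)) b else \<zero>)"
proof (cases "j \<le> n")
  case True
  have "skew_prod f (monomial b j) n = (\<Oplus>i\<in>{..n}. if n - j = i then f i \<otimes> (\<tau> ^^ i) b else \<zero>)"
    unfolding skew_prod_def
    by (rule finsum_cong') (use f b True in \<open>auto simp: monomial_def\<close>)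
  also have "\<dots> = f (n - j) \<otimes> (\<tau> ^^ (n - j)) b"
    using f b by (intro finsum_singleton) auto
  finally show ?thesis using True by simp
next
  case False
  have "skew_prod f (monomial b j) n = (\<Oplus>i\<in>{..n}. \<zero>)"
    unfolding skew_prod_def
    by (rule finsum_cong') (use f b False in \<open>auto simp: monomial_def\<close>)
  then show ?thesis using False by simp
qed

lemma skew_prod_monomial_left:
  assumes g: "\<And>n. g n \<in> carrier R" and a: "a \<in> carrier R"
  shows "skew_prod (monomial a j) g n = (if j \<le> n then a \<otimes> (\<tau> ^^ j) (g (n - j)) else \<zero>)"
proof (cases "j \<le> n")
  case True
  have "skew_prod (monomial a j) g n = (\<Oplus>i\<in>{..n}. if j = i then a \<otimes> (\<tau> ^^ i) (g (n - i)) else \<zero>)"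
    unfolding skew_prod_def
    by (rule finsum_cong') (use g a True in \<open>auto simp: monomial_def\<close>)
  also have "\<dots> = a \<otimes> (\<tau> ^^ j) (g (n - j))"
    using g a True by (intro finsum_singleton) auto
  finally show ?thesis using True by simp
next
  case False
  have "skew_prod (monomial a j) g n = (\<Oplus>i\<in>{..n}. \<zero>)"
    unfolding skew_prod_def
    by (rule finsum_cong') (use g a False in \<open>auto simp: monomial_def\<close>)
  then show ?thesis using False by simp
qed

lemma monomial_closed: "a \<in> carrier R \<Longrightarrow> monomial a j n \<in> carrier R" by (simp add: monomial_def)

lemma mult_skew_poly: "f \<otimes>\<^bsub>skew_poly R \<tau>\<^esub> g = skew_prod f g"
  by (simp add: skew_poly_def skew_prod_def)

lemma var_poly_pow: "var_poly R [^]\<^bsub>skew_poly R \<tau>\<^esub> n = monomial \<one> n"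
proof (induction n)
  case 0
  show ?case by (simp add: nat_pow_def skew_poly_def monomial_def)
next
  case (Suc n)
  have v: "var_poly R = monomial \<one> 1" by (simp add: var_poly_def monomial_def)
  have "var_poly R [^]\<^bsub>skew_poly R \<tau>\<^esub> Suc n = skew_prod (monomial \<one> n) (monomial \<one> 1)"
    using Suc by (simp add: nat_pow_def mult_skew_poly v)
  also have "\<dots> = monomial \<one> (Suc n)"
    by (rule ext) (subst skew_prod_monomial_right, auto simp: monomial_def)
  finally show ?case .
qed

text \<open>The polynomial \<open>t\<^sup>q - c\<close>.\<close>

definition binomial :: "nat \<Rightarrow> 'a" where "binomial = (\<lambda>n. monomial \<one> q n \<oplus> monomial (\<ominus> c) 0 n)"

lemma skew_binomial_eq: "skew_binomial R \<tau> q c = binomial"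
proof -
  have "\<ominus>\<^bsub>skew_poly R \<tau>\<^esub> (monomial c 0) = monomial (\<ominus> c) 0"
    unfolding a_inv_def[of "skew_poly R \<tau>"] m_inv_def[of "add_monoid (skew_poly R \<tau>)"]
  proof (rule the_equality)
    show "monomial (\<ominus> c) 0 \<in> carrier (add_monoid (skew_poly R \<tau>)) \<and>
      monomial c 0 \<otimes>\<^bsub>add_monoid (skew_poly R \<tau>)\<^esub> monomial (\<ominus> c) 0 = \<one>\<^bsub>add_monoid (skew_poly R \<tau>)\<^esub> \<and>
      monomial (\<ominus> c) 0 \<otimes>\<^bsub>add_monoid (skew_poly R \<tau>)\<^esub> monomial c 0 = \<one>\<^bsub>add_monoid (skew_poly R \<tau>)\<^esub>"
      using c_closed monomial_up[of "\<ominus> c" 0]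
      by (auto simp: skew_poly_def monomial_def fun_eq_iff r_neg l_neg)
  next
    fix y assume y: "y \<in> carrier (add_monoid (skew_poly R \<tau>)) \<and>
      monomial c 0 \<otimes>\<^bsub>add_monoid (skew_poly R \<tau>)\<^esub> y = \<one>\<^bsub>add_monoid (skew_poly R \<tau>)\<^esub> \<and>
      y \<otimes>\<^bsub>add_monoid (skew_poly R \<tau>)\<^esub> monomial c 0 = \<one>\<^bsub>add_monoid (skew_poly R \<tau>)\<^esub>"
    then have yc: "y n \<in> carrier R" and e: "y n \<oplus> monomial c 0 n = \<zero>" for n
      by (auto simp: skew_poly_def fun_eq_iff)
    show "y = monomial (\<ominus> c) 0"
    proof
      fix n
      show "y n = monomial (\<ominus> c) 0 n"
        using minus_equality[OF e[of n] monomial_closed[OF c_closed] yc[of n]]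
        by (auto simp: monomial_def split: if_splits)
    qed
  qed
  then show ?thesis
    unfolding skew_binomial_def a_minus_def var_poly_pow const_poly_monomial
    by (simp add: binomial_def skew_poly_def)
qed

lemma binomial_closed [simp]: "binomial n \<in> carrier R"
  using c_closed by (simp add: binomial_def monomial_def)

lemma binomial_up: "binomial \<in> up R"
  using c_closed by (intro mem_upI) (auto intro!: exI[of _ q] bound.intro simp: binomial_def monomial_def)

lemma deg_binomial: "deg R binomial = q"
proof -
  have co: "up_ring.coeff (UP R) binomial = binomial" using binomial_up by (simp add: UP_def)
  show ?thesis unfolding deg_def co
  proof (rule Least_equality)
    show "bound \<zero> q binomial" by (rule bound.intro) (auto simp: binomial_def monomial_def)
    show "q \<le> n" if "bound \<zero> n binomial" for n
      by (rule bound_below[OF that]) (use q2 one_neq_zero in \<open>auto simp: binomial_def monomial_def\<close>)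
  qed
qed

lemma skew_prod_binomial:
  assumes s: "\<And>n. s n \<in> carrier R"
  shows "skew_prod s binomial n = (if q \<le> n then s (n - q) else \<zero>) \<oplus> s n \<otimes> \<ominus> c"
proof -
  have "skew_prod s binomial n = (\<Oplus>i\<in>{..n}. s i \<otimes> (\<tau> ^^ i) (monomial \<one> q (n - i)) \<oplus>
      s i \<otimes> (\<tau> ^^ i) (monomial (\<ominus> c) 0 (n - i)))"
    unfolding skew_prod_def
  proof (rule finsum_cong'[OF refl])
    show "s i \<otimes> (\<tau> ^^ i) (binomial (n - i)) =
        s i \<otimes> (\<tau> ^^ i) (monomial \<one> q (n - i)) \<oplus> s i \<otimes> (\<tau> ^^ i) (monomial (\<ominus> c) 0 (n - i))" for i
      unfolding binomial_def using s[of i] c_closed by (simp add: monomial_closed r_distr)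
  qed (use s c_closed in \<open>auto simp: monomial_closed\<close>)
  also have "\<dots> = skew_prod s (monomial \<one> q) n \<oplus> skew_prod s (monomial (\<ominus> c) 0) n"
    unfolding skew_prod_def using s c_closed by (intro finsum_addf) (auto simp: monomial_closed)
  also have "\<dots> = (if q \<le> n then s (n - q) else \<zero>) \<oplus> s n \<otimes> \<ominus> c"
    using s c_closed by (simp add: skew_prod_monomial_right)
  finally show ?thesis .
qed

abbreviation skew_quot :: "(nat \<Rightarrow> 'a) ring" where "skew_quot \<equiv> skew_poly_quotient R \<tau> (skew_binomial R \<tau> q c)"

lemma carrier_skew_quot: "carrier skew_quot = {g. (\<forall>n. g n \<in> carrier R) \<and> (\<forall>n\<ge>q. g n = \<zero>)}"
proof -
  have "g \<in> up R" if "\<And>n. g n \<in> carrier R" "\<And>n. q \<le> n \<Longrightarrow> g n = \<zero>" for g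
    using that by (intro mem_upI) (auto intro!: exI[of _ q])
  then show ?thesis
    by (auto simp: skew_poly_quotient_def Let_def skew_binomial_eq deg_binomial)
qed

lemma skew_quot_simps:
  "f \<oplus>\<^bsub>skew_quot\<^esub> g = (\<lambda>n. f n \<oplus> g n)" "\<zero>\<^bsub>skew_quot\<^esub> = (\<lambda>n. \<zero>)" "\<one>\<^bsub>skew_quot\<^esub> = monomial \<one> 0"
  by (auto simp: skew_poly_quotient_def Let_def skew_poly_def monomial_def)

lemma skew_quotD: "g \<in> carrier skew_quot \<Longrightarrow> g n \<in> carrier R" "g \<in> carrier skew_quot \<Longrightarrow> q \<le> n \<Longrightarrow> g n = \<zero>"
  by (auto simp: carrier_skew_quot)

lemma monomial_in_skew_quot: "a \<in> carrier R \<Longrightarrow> j < q \<Longrightarrow> monomial a j \<in> carrier skew_quot"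
  by (auto simp: carrier_skew_quot monomial_def)

text \<open>Comparing coefficients in degree \<open>n + q\<close>, where the remainders vanish, gives \<open>s\<^sub>n\<close> in terms of
  \<open>s\<^sub>n\<^sub>+\<^sub>q\<close>; since the quotients have finite support, descending induction shows that they agree.\<close>

lemma remainder_unique:
  assumes r: "r \<in> carrier skew_quot" "r' \<in> carrier skew_quot" and s: "s \<in> up R" "s' \<in> up R"
    and eq: "\<And>n. skew_prod s binomial n \<oplus> r n = skew_prod s' binomial n \<oplus> r' n"
  shows "r = r'"
proof -
  have sc: "s n \<in> carrier R" "s' n \<in> carrier R" for n using s by auto
  obtain m m' where "bound \<zero> m s" "bound \<zero> m' s'" using s by (auto simp: up_def)
  then have big: "s n = s' n" if "n > max m m'" for n
    using that by (simp add: bound.bound)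
  have "s n = s' n" for n
  proof (induction "Suc (max m m') - n" arbitrary: n rule: less_induct)
    case less
    show ?case
    proof (cases "n > max m m'")
      case False
      have "s (n + q) = s' (n + q)"
        using False q2 by (intro less) linarith
      moreover have "s n \<oplus> s (n + q) \<otimes> \<ominus> c = s' n \<oplus> s' (n + q) \<otimes> \<ominus> c"
        using eq[of "n + q"] sc skew_quotD[OF r(1), of "n + q"] skew_quotD[OF r(2), of "n + q"] c_closed
        by (simp add: skew_prod_binomial)
      ultimately show ?thesis using sc c_closed by simp
    qed (rule big)
  qed
  then have "s = s'" by auto
  then have "r n = r' n" for n
    using eq[of n] skew_prod_closed[of s' binomial n] sc skew_quotD(1)[OF r(1), of n] skew_quotD(1)[OF r(2), of n] by simp
  then show ?thesis by auto
qed

text \<open>A product of two polynomials of degree less than \<open>q\<close> has degree less than \<open>2q\<close>, so that one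
  substitution \<open>t\<^sup>q = c\<close> in the upper half is the whole division. All further computations in
  the quotient go through this explicit formula.\<close>

lemma mult_skew_quot:
  assumes g: "g \<in> carrier skew_quot" and h: "h \<in> carrier skew_quot"
  shows "g \<otimes>\<^bsub>skew_quot\<^esub> h = (\<lambda>n. if n < q then skew_prod g h n \<oplus> skew_prod g h (n + q) \<otimes> c else \<zero>)" (is "_ = ?r")
proof -
  note gc = skew_quotD(1)[OF g] and hc = skew_quotD(1)[OF h]
  have pc: "skew_prod g h n \<in> carrier R" for n by (rule skew_prod_closed[OF gc hc])
  have p0: "skew_prod g h n = \<zero>" if n: "n \<ge> 2 * q" for n
  proof -
    have "skew_prod g h n = (\<Oplus>i\<in>{..n}. \<zero>)"
      unfolding skew_prod_def
    proof (rule finsum_cong'[OF refl])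
      show "g i \<otimes> (\<tau> ^^ i) (h (n - i)) = \<zero>" for i
      proof (cases "q \<le> i")
        case True
        then show ?thesis using skew_quotD(2)[OF g] hc by simp
      next
        case False
        then have "q \<le> n - i" using n by linarith
        then show ?thesis using skew_quotD(2)[OF h] gc by simp
      qed
    qed simp
    then show ?thesis by simp
  qed
  \<comment> \<open>The quotient of the division is the upper half of the product.\<close>
  let ?s = "\<lambda>n. if n < q then skew_prod g h (n + q) else \<zero>"
  have rS: "?r \<in> carrier skew_quot" using pc c_closed by (auto simp: carrier_skew_quot)
  have sup: "?s \<in> up R" using pc by (intro mem_upI) (auto intro!: exI[of _ q])
  have sc: "?s n \<in> carrier R" for n using pc by simp
  have div: "skew_prod g h n = skew_prod ?s binomial n \<oplus> ?r n" for n
  proof -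
    consider "n < q" | "q \<le> n" "n < 2 * q" | "2 * q \<le> n" by linarith
    then show ?thesis
    proof cases
      case 1
      then show ?thesis
        using pc[of n] pc[of "n + q"] c_closed
        by (simp add: skew_prod_binomial[OF sc] r_minus a_ac r_neg)
    next
      case 2
      then have "n - q < q" by linarith
      with 2 show ?thesis using pc[of n] c_closed by (simp add: skew_prod_binomial[OF sc])
    next
      case 3
      then have "\<not> n - q < q" "\<not> n < q" "q \<le> n" by linarith+
      with 3 show ?thesis using p0 c_closed by (simp add: skew_prod_binomial[OF sc])
    qed
  qed
  have "g \<otimes>\<^bsub>skew_quot\<^esub> h = (THE r. r \<in> carrier skew_quot \<and>
      (\<exists>s\<in>up R. skew_prod g h = (\<lambda>n. skew_prod s binomial n \<oplus> r n)))"
    by (simp add: skew_poly_quotient_def Let_def skew_poly_def skew_prod_def skew_binomial_eq)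
  also have "\<dots> = ?r"
  proof (rule the_equality)
    show "?r \<in> carrier skew_quot \<and> (\<exists>s\<in>up R. skew_prod g h = (\<lambda>n. skew_prod s binomial n \<oplus> ?r n))"
      using rS sup div by blast
    fix r assume "r \<in> carrier skew_quot \<and> (\<exists>s\<in>up R. skew_prod g h = (\<lambda>n. skew_prod s binomial n \<oplus> r n))"
    then obtain s where s: "r \<in> carrier skew_quot" "s \<in> up R" and e: "skew_prod g h = (\<lambda>n. skew_prod s binomial n \<oplus> r n)"
      by blast
    have "skew_prod s binomial n \<oplus> r n = skew_prod ?s binomial n \<oplus> ?r n" for n
      using fun_cong[OF e, of n, symmetric] div[of n] by (rule trans)
    then show "r = ?r" by (rule remainder_unique[OF s(1) rS s(2) sup])
  qed
  finally show ?thesis .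
qed

lemma const_mult:
  assumes a: "a \<in> carrier R" and g: "g \<in> carrier skew_quot"
  shows "monomial a 0 \<otimes>\<^bsub>skew_quot\<^esub> g = (\<lambda>n. a \<otimes> g n)"
  using q2 a skew_quotD[OF g] c_closed
  by (subst mult_skew_quot[OF monomial_in_skew_quot g]) (auto simp: skew_prod_monomial_left)

lemma mult_const:
  assumes b: "b \<in> carrier R" and g: "g \<in> carrier skew_quot"
  shows "g \<otimes>\<^bsub>skew_quot\<^esub> monomial b 0 = (\<lambda>n. g n \<otimes> (\<tau> ^^ n) b)"
  using q2 b skew_quotD[OF g] c_closed
  by (subst mult_skew_quot[OF g monomial_in_skew_quot]) (auto simp: skew_prod_monomial_right)

lemma complementary_powers_mult:
  assumes "d < q" "e < q" "d + e = q"
  shows "monomial \<one> d \<otimes>\<^bsub>skew_quot\<^esub> monomial \<one> e = monomial c 0"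
proof -
  have eq: "skew_prod (monomial \<one> d) (monomial \<one> e) = monomial \<one> q"
  proof
    fix n
    show "skew_prod (monomial \<one> d) (monomial \<one> e) n = monomial \<one> q n"
      using assms by (subst skew_prod_monomial_right) (auto simp: monomial_def)
  qed
  have m: "monomial \<one> d \<in> carrier skew_quot" "monomial \<one> e \<in> carrier skew_quot"
    using monomial_in_skew_quot assms by blast+
  show ?thesis
    unfolding mult_skew_quot[OF m] eq using q2 c_closed by (auto simp: monomial_def)
qed

text \<open>The intertwining relation turns the right ideal \<open>uR\<close> into a left ideal and \<open>Ru\<close> into a right
  ideal, so simplicity of \<open>R\<close> gives one-sided inverses on both sides.\<close>

lemma twisted_unit:
  assumes u: "u \<in> carrier R" "u \<noteq> \<zero>"
    and tw: "\<And>b. b \<in> carrier R \<Longrightarrow> (\<tau> ^^ d) b \<otimes> u = u \<otimes> (\<tau> ^^ j) b"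
  shows "u \<in> Units R"
proof -
  have dichotomy: "I = {\<zero>} \<or> I = carrier R" if "ideal I R" for I
    using that simple by (simp add: simple_ring_def)
  let ?I = "(\<lambda>b. u \<otimes> b) ` carrier R" and ?J = "(\<lambda>b. b \<otimes> u) ` carrier R"
  have sub: "subgroup (f ` carrier R) (add_monoid R)"
    if f: "\<And>x. x \<in> carrier R \<Longrightarrow> f x \<in> carrier R"
      "\<And>x y. x \<in> carrier R \<Longrightarrow> y \<in> carrier R \<Longrightarrow> f (x \<oplus> y) = f x \<oplus> f y" for f
  proof -
    interpret f: abelian_group_hom R R f
      by (rule abelian_group_homI) (use f in \<open>auto simp: abelian_group_axioms hom_def
        group_hom_def group_hom_axioms_def add.group_axioms\<close>)
    show ?thesis
      using group_hom.img_is_subgroup[OF f.a_group_hom] by simp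
  qed
  have "ideal ?I R"
  proof (rule idealI[OF ring_axioms])
    show "subgroup ?I (add_monoid R)" by (rule sub) (use u in \<open>auto simp: r_distr\<close>)
    fix a x assume "a \<in> ?I" and x: "x \<in> carrier R"
    then obtain b where b: "b \<in> carrier R" "a = u \<otimes> b" by auto
    obtain x' where x': "x' \<in> carrier R" "(\<tau> ^^ d) x' = x" using pow_surj[OF x] by blast
    have "x \<otimes> a = u \<otimes> ((\<tau> ^^ j) x' \<otimes> b)"
      using tw[OF x'(1)] x' x u b by (simp add: m_assoc[symmetric])
    then show "x \<otimes> a \<in> ?I" using x' b by auto
    show "a \<otimes> x \<in> ?I" using b x u by (auto simp: m_assoc)
  qed
  moreover have "u \<in> ?I" using u by (auto intro!: image_eqI[of _ _ \<one>])
  ultimately have "\<one> \<in> ?I" using dichotomy u one_closed by blast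
  then obtain v where v: "v \<in> carrier R" "u \<otimes> v = \<one>" by auto
  have "ideal ?J R"
  proof (rule idealI[OF ring_axioms])
    show "subgroup ?J (add_monoid R)" by (rule sub) (use u in \<open>auto simp: l_distr\<close>)
    fix a x assume "a \<in> ?J" and x: "x \<in> carrier R"
    then obtain b where b: "b \<in> carrier R" "a = b \<otimes> u" by auto
    obtain x' where x': "x' \<in> carrier R" "(\<tau> ^^ j) x' = x" using pow_surj[OF x] by blast
    have "a \<otimes> x = b \<otimes> (\<tau> ^^ d) x' \<otimes> u"
      using tw[OF x'(1)] x' x u b by (simp add: m_assoc)
    then show "a \<otimes> x \<in> ?J" using x' b by auto
    show "x \<otimes> a \<in> ?J" using b x u by (auto simp: m_assoc[symmetric])
  qed
  moreover have "u \<in> ?J" using u by (auto intro!: image_eqI[of _ _ \<one>])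
  ultimately have "\<one> \<in> ?J" using dichotomy u one_closed by blast
  then obtain w where w: "w \<in> carrier R" "w \<otimes> u = \<one>" by auto
  have "w = w \<otimes> (u \<otimes> v)" using v w by simp
  also have "\<dots> = v" using v(1) w u by (simp add: m_assoc[symmetric])
  finally show ?thesis using v w u by (auto simp: Units_def)
qed

text \<open>A unit \<open>u\<close> intertwining \<open>\<tau>\<^sup>d\<close> and \<open>\<tau>\<^sup>j\<close> would make \<open>\<tau>\<^sup>|\<^sup>j\<^sup>-\<^sup>d\<^sup>|\<close> inner, against the inner
  order \<open>q\<close>. Both the centre and the simplicity of the quotient rest on this lemma.\<close>

lemma twisted_zero:
  assumes dj: "d \<noteq> j" "d < q" "j < q" and u: "u \<in> carrier R"
    and tw: "\<And>b. b \<in> carrier R \<Longrightarrow> (\<tau> ^^ d) b \<otimes> u = u \<otimes> (\<tau> ^^ j) b"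
  shows "u = \<zero>"
proof (rule ccontr)
  assume "u \<noteq> \<zero>"
  then have U: "u \<in> Units R" by (rule twisted_unit[OF u _ tw])
  have not_inner: "\<not> inner_automorphism R (\<tau> ^^ e)" if "0 < e" "e < q" for e
    using order that by (simp add: has_inner_order_def)
  show False
  proof (cases "d < j")
    case True
    have "(\<tau> ^^ (j - d)) x = inv u \<otimes> x \<otimes> inv (inv u)" if x: "x \<in> carrier R" for x
    proof -
      obtain b where b: "b \<in> carrier R" "(\<tau> ^^ d) b = x" using pow_surj[OF x] by blast
      have "(\<tau> ^^ (j - d)) x = (\<tau> ^^ j) b"
        using b(2) True by (metis comp_apply funpow_add le_add_diff_inverse2 less_imp_le)
      then have "x \<otimes> u = u \<otimes> (\<tau> ^^ (j - d)) x" using tw[OF b(1)] b(2) by simp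
      then have "inv u \<otimes> (x \<otimes> u) = (\<tau> ^^ (j - d)) x"
        using U u x by (simp add: m_assoc[symmetric])
      then show ?thesis using U u x by (simp add: m_assoc)
    qed
    then have "inner_automorphism R (\<tau> ^^ (j - d))"
      using U unfolding inner_automorphism_def by blast
    then show False using not_inner[of "j - d"] True dj by simp
  next
    case False
    have "(\<tau> ^^ (d - j)) x = u \<otimes> x \<otimes> inv u" if x: "x \<in> carrier R" for x
    proof -
      obtain b where b: "b \<in> carrier R" "(\<tau> ^^ j) b = x" using pow_surj[OF x] by blast
      have "(\<tau> ^^ (d - j)) x = (\<tau> ^^ d) b"
        using b(2) False by (metis comp_apply funpow_add le_add_diff_inverse2 not_less)
      then have "(\<tau> ^^ (d - j)) x \<otimes> u = u \<otimes> x" using tw[OF b(1)] b(2) by simp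
      then have "u \<otimes> x \<otimes> inv u = (\<tau> ^^ (d - j)) x \<otimes> u \<otimes> inv u" by simp
      then show ?thesis using U u x by (simp add: m_assoc)
    qed
    then have "inner_automorphism R (\<tau> ^^ (d - j))"
      using U unfolding inner_automorphism_def by blast
    then show False using not_inner[of "d - j"] False dj by simp
  qed
qed

text \<open>Commuting with a constant \<open>b\<close> means \<open>b z\<^sub>n = z\<^sub>n \<tau>\<^sup>n(b)\<close> for each coefficient, so that only the
  constant coefficient survives and is central; commuting with \<open>t\<close> makes it \<open>\<tau>\<close>-invariant.\<close>

lemma center_skew_quot: "ring_center skew_quot = (\<lambda>z. monomial z 0) ` {z \<in> ring_center R. \<tau> z = z}"
proof
  have q0: "0 < q" "1 < q" using q2 by auto
  show "ring_center skew_quot \<subseteq> (\<lambda>z. monomial z 0) ` {z \<in> ring_center R. \<tau> z = z}"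
  proof
    fix z assume "z \<in> ring_center skew_quot"
    then have z: "z \<in> carrier skew_quot" and comm: "\<And>g. g \<in> carrier skew_quot \<Longrightarrow> z \<otimes>\<^bsub>skew_quot\<^esub> g = g \<otimes>\<^bsub>skew_quot\<^esub> z"
      by (auto simp: ring_center_def)
    have cb: "b \<otimes> z n = z n \<otimes> (\<tau> ^^ n) b" if b: "b \<in> carrier R" for b n
      using fun_cong[OF comm[OF monomial_in_skew_quot[OF b q0(1)]], of n] const_mult[OF b z] mult_const[OF b z]
      by simp
    have "z n = \<zero>" if "n \<noteq> 0" for n
    proof (cases "n < q")
      case True
      show ?thesis
        by (rule twisted_zero[of 0 n]) (use True that q0 skew_quotD(1)[OF z] cb in auto)
    qed (use skew_quotD(2)[OF z] in auto)
    then have zm: "z = monomial (z 0) 0" by (auto simp: monomial_def)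
    have z0: "z 0 \<in> carrier R" by (rule skew_quotD(1)[OF z])
    have "z 0 \<in> ring_center R" using z0 cb[of _ 0] by (auto simp: ring_center_def)
    moreover have "\<tau> (z 0) = z 0"
    proof -
      have t: "monomial \<one> 1 \<in> carrier skew_quot" by (rule monomial_in_skew_quot) (use q0 in auto)
      have "(monomial (z 0) 0 \<otimes>\<^bsub>skew_quot\<^esub> monomial \<one> 1) 1 = (monomial \<one> 1 \<otimes>\<^bsub>skew_quot\<^esub> monomial (z 0) 0) 1"
        using comm[OF t] zm by simp
      then show ?thesis
        unfolding const_mult[OF z0 t] mult_const[OF z0 t]
        using z0 pow_closed[OF z0, of 1] by (simp add: monomial_def)
    qed
    ultimately show "z \<in> (\<lambda>z. monomial z 0) ` {z \<in> ring_center R. \<tau> z = z}" using zm by blast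
  qed
  show "(\<lambda>z. monomial z 0) ` {z \<in> ring_center R. \<tau> z = z} \<subseteq> ring_center skew_quot"
  proof clarify
    fix z assume z: "z \<in> ring_center R" "\<tau> z = z"
    have zc: "z \<in> carrier R" and zz: "\<And>x. x \<in> carrier R \<Longrightarrow> z \<otimes> x = x \<otimes> z"
      using z(1) by (auto simp: ring_center_def)
    have "(\<tau> ^^ n) z = z" for n by (induction n) (auto simp: z(2))
    then show "monomial z 0 \<in> ring_center skew_quot"
      unfolding ring_center_def using monomial_in_skew_quot[OF zc q0(1)] zz skew_quotD(1)
      by (auto simp: const_mult[OF zc] mult_const[OF zc])
  qed
qed

text \<open>Let \<open>x\<close> in \<open>I\<close> have the smallest non-empty support and let \<open>d\<close> belong to it. The coefficients at
  \<open>d\<close> of the elements of \<open>I\<close> supported inside that of \<open>x\<close> form an ideal of \<open>R\<close>, so one of these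
  elements, \<open>y\<close>, has coefficient \<open>1\<close> at \<open>d\<close>. Then \<open>\<tau>\<^sup>d(b) y - y b\<close> has smaller support, so it
  vanishes, and \<open>twisted_zero\<close> leaves only \<open>y = t\<^sup>d\<close>, a divisor of the unit \<open>t\<^sup>q = c\<close>.\<close>

lemma one_in_twosided:
  assumes I: "I \<subseteq> carrier skew_quot" "x0 \<in> I" "x0 \<noteq> \<zero>\<^bsub>skew_quot\<^esub>"
    and add: "\<And>x y. x \<in> I \<Longrightarrow> y \<in> I \<Longrightarrow> x \<oplus>\<^bsub>skew_quot\<^esub> y \<in> I"
    and left: "\<And>x g. x \<in> I \<Longrightarrow> g \<in> carrier skew_quot \<Longrightarrow> g \<otimes>\<^bsub>skew_quot\<^esub> x \<in> I"
    and right: "\<And>x g. x \<in> I \<Longrightarrow> g \<in> carrier skew_quot \<Longrightarrow> x \<otimes>\<^bsub>skew_quot\<^esub> g \<in> I"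
  shows "\<one>\<^bsub>skew_quot\<^esub> \<in> I"
proof -
  have q0: "0 < q" using q2 by simp
  \<comment> \<open>Elements of smallest support, not of smallest degree: multiplying by \<open>t\<close> would shift the
    support cyclically, whereas constants on either side do not enlarge it.\<close>
  define supp where "supp x = {n. x n \<noteq> \<zero>}" for x :: "nat \<Rightarrow> 'a"
  have finsupp: "finite (supp x)" if "x \<in> I" for x
  proof (rule finite_subset)
    have "x \<in> carrier skew_quot" using that I(1) by blast
    then show "supp x \<subseteq> {..<q}" by (auto simp: supp_def carrier_skew_quot) (metis not_le)
  qed simp
  have lm: "(\<lambda>n. a \<otimes> x n) \<in> I" if "x \<in> I" "a \<in> carrier R" for x a
    using left[OF that(1) monomial_in_skew_quot[OF that(2) q0]] const_mult[OF that(2)] that(1) I(1) by auto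
  have rm: "(\<lambda>n. x n \<otimes> (\<tau> ^^ n) b) \<in> I" if "x \<in> I" "b \<in> carrier R" for x b
    using right[OF that(1) monomial_in_skew_quot[OF that(2) q0]] mult_const[OF that(2)] that(1) I(1) by auto
  have addI: "(\<lambda>n. x n \<oplus> y n) \<in> I" if "x \<in> I" "y \<in> I" for x y
    using add[OF that] by (simp add: skew_quot_simps)
  have Ic: "x n \<in> carrier R" if "x \<in> I" for x n using that I(1) skew_quotD(1) by blast
  have negI: "(\<lambda>n. \<ominus> x n) \<in> I" if "x \<in> I" for x
  proof -
    have "(\<lambda>n. \<ominus> x n) = (\<lambda>n. \<ominus> \<one> \<otimes> x n)" using Ic[OF that] by (auto simp: l_minus)
    then show ?thesis using lm[OF that, of "\<ominus> \<one>"] by simp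
  qed
  let ?P = "\<lambda>x. x \<in> I \<and> supp x \<noteq> {}"
  have "?P x0" using I(2,3) by (auto simp: supp_def skew_quot_simps)
  then obtain x where x: "?P x" and min: "\<And>y. ?P y \<Longrightarrow> card (supp x) \<le> card (supp y)"
    using ex_has_least_nat[of ?P x0 "\<lambda>x. card (supp x)"] by blast
  obtain d where d: "d \<in> supp x" using x by auto
  have dq: "d < q" using d x I(1) skew_quotD(2)[of x d] by (auto simp: supp_def not_le[symmetric])
  have minimal: "supp w = {}" if w: "w \<in> I" "supp w \<subseteq> supp x" "w d = \<zero>" for w
  proof (rule ccontr)
    assume "supp w \<noteq> {}"
    then have "card (supp x) \<le> card (supp w)" using min w(1) by blast
    moreover have "supp w \<subset> supp x" using w d by (auto simp: supp_def)
    then have "card (supp w) < card (supp x)" using x by (intro psubset_card_mono finsupp) auto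
    ultimately show False by simp
  qed
  have suppI: "supp w \<subseteq> supp x" if "\<And>n. x n = \<zero> \<Longrightarrow> w n = \<zero>" for w
    using that by (auto simp: supp_def)
  have suppD: "w n = \<zero>" if "supp w \<subseteq> supp x" "x n = \<zero>" for w n
    using that by (auto simp: supp_def)
  define J where "J = {y d | y. y \<in> I \<and> supp y \<subseteq> supp x}"
  have JI: "a \<in> J" if "y \<in> I" "supp y \<subseteq> supp x" "a = y d" for a y
    using that by (auto simp: J_def)
  have JE: "\<exists>y. y \<in> I \<and> supp y \<subseteq> supp x \<and> a = y d" if "a \<in> J" for a
    using that by (auto simp: J_def)
  have "ideal J R"
  proof (rule idealI[OF ring_axioms])
    show "subgroup J (add_monoid R)"
    proof (rule add.subgroupI)
      show "J \<subseteq> carrier R" using Ic JE by blast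
      show "J \<noteq> {}" using JI[of x] x by blast
      fix a assume "a \<in> J"
      then obtain y where y: "y \<in> I" "supp y \<subseteq> supp x" "a = y d" using JE by blast
      have "supp (\<lambda>n. \<ominus> y n) \<subseteq> supp x" by (rule suppI) (simp add: suppD[OF y(2)])
      then show "\<ominus> a \<in> J" by (rule JI[OF negI[OF y(1)]]) (simp add: y(3))
      fix b assume "b \<in> J"
      then obtain z where z: "z \<in> I" "supp z \<subseteq> supp x" "b = z d" using JE by blast
      have "supp (\<lambda>n. y n \<oplus> z n) \<subseteq> supp x" by (rule suppI) (simp add: suppD[OF y(2)] suppD[OF z(2)])
      then show "a \<oplus> b \<in> J" by (rule JI[OF addI[OF y(1) z(1)]]) (simp add: y(3) z(3))
    qed
    fix a r assume "a \<in> J" and r: "r \<in> carrier R"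
    then obtain y where y: "y \<in> I" "supp y \<subseteq> supp x" "a = y d" using JE by blast
    have "supp (\<lambda>n. r \<otimes> y n) \<subseteq> supp x" by (rule suppI) (simp add: suppD[OF y(2)] r)
    then show "r \<otimes> a \<in> J" by (rule JI[OF lm[OF y(1) r]]) (simp add: y(3))
    obtain b where b: "b \<in> carrier R" "(\<tau> ^^ d) b = r" using pow_surj[OF r] by blast
    have "supp (\<lambda>n. y n \<otimes> (\<tau> ^^ n) b) \<subseteq> supp x" by (rule suppI) (simp add: suppD[OF y(2)] b(1))
    then show "a \<otimes> r \<in> J" by (rule JI[OF rm[OF y(1) b(1)]]) (simp add: y(3) b(2))
  qed
  then have "J = {\<zero>} \<or> J = carrier R" using simple by (simp add: simple_ring_def)
  moreover have "x d \<in> J" "x d \<noteq> \<zero>" using JI[of x] x d by (auto simp: supp_def)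
  ultimately have "\<one> \<in> J" by auto
  then obtain y where y: "y \<in> I" "supp y \<subseteq> supp x" "y d = \<one>" using JE by metis
  have tw: "(\<tau> ^^ d) b \<otimes> y n = y n \<otimes> (\<tau> ^^ n) b" if b: "b \<in> carrier R" for b n
  proof -
    let ?w = "\<lambda>n. (\<tau> ^^ d) b \<otimes> y n \<oplus> \<ominus> (y n \<otimes> (\<tau> ^^ n) b)"
    have "?w \<in> I" by (rule addI[OF lm[OF y(1)] negI[OF rm[OF y(1) b]]]) (use b in auto)
    moreover have "supp ?w \<subseteq> supp x" by (rule suppI) (simp add: suppD[OF y(2)] b)
    moreover have "?w d = \<zero>" using y(3) b by (simp add: r_neg)
    ultimately have "supp ?w = {}" by (rule minimal)
    then have "(\<tau> ^^ d) b \<otimes> y n \<ominus> y n \<otimes> (\<tau> ^^ n) b = \<zero>" by (auto simp: supp_def a_minus_def)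
    then show ?thesis using b Ic[OF y(1)] by simp
  qed
  have "y n = monomial \<one> d n" for n
  proof (cases "n < q \<and> n \<noteq> d")
    case True
    then have "y n = \<zero>" by (intro twisted_zero[of d n]) (use dq Ic[OF y(1)] tw in auto)
    then show ?thesis using True by (simp add: monomial_def)
  next
    case False
    then consider "n = d" | "n \<noteq> d" "q \<le> n" by linarith
    then show ?thesis
    proof cases
      case 2
      moreover have "y \<in> carrier skew_quot" using y(1) I(1) by blast
      ultimately show ?thesis using skew_quotD(2)[of y n] by (simp add: monomial_def)
    qed (simp add: y(3) monomial_def)
  qed
  then have "y = monomial \<one> d" by (rule ext)
  then have ym: "monomial \<one> d \<in> I" using y(1) by simp
  show ?thesis
  proof (cases "d = 0")
    case True
    then show ?thesis using ym by (simp add: skew_quot_simps)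
  next
    case False
    have "monomial \<one> (q - d) \<in> carrier skew_quot" by (rule monomial_in_skew_quot) (use False dq in auto)
    then have "monomial c 0 \<in> I"
      using right[OF ym, of "monomial \<one> (q - d)"] complementary_powers_mult[of d "q - d"] False dq by simp
    from lm[OF this Units_inv_closed[OF c_unit]]
    have "(\<lambda>n. inv c \<otimes> monomial c 0 n) \<in> I" .
    moreover have "(\<lambda>n. inv c \<otimes> monomial c 0 n) = monomial \<one> 0"
      using c_unit by (auto simp: monomial_def)
    ultimately show ?thesis by (simp add: skew_quot_simps)
  qed
qed

text \<open>Transport of the two results along a ring isomorphism. The map \<open>\<beta>\<close> reads off the constant
  coefficient, and the last clause makes it compatible with a common central subfield.\<close>

lemma
  assumes R': "ring R'" and h: "h \<in> ring_iso R' skew_quot"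
  shows iso_simple: "simple_ring R'"
    and iso_center: "\<exists>\<beta>\<in>ring_hom (R'\<lparr>carrier := ring_center R'\<rparr>) R.
      \<beta> ` ring_center R' = {z \<in> ring_center R. \<tau> z = z} \<and>
      (\<forall>x\<in>ring_center R'. \<forall>a. h x = const_poly R a \<longrightarrow> \<beta> x = a)"
proof -
  interpret R': ring R' by (rule R')
  have hh: "h \<in> ring_hom R' skew_quot" and bij: "bij_betw h (carrier R') (carrier skew_quot)"
    using h by (auto simp: ring_iso_def)
  have inj: "h x = h y \<longleftrightarrow> x = y" if "x \<in> carrier R'" "y \<in> carrier R'" for x y
    using bij that by (auto simp: bij_betw_def inj_on_def)
  have surj: "\<exists>x\<in>carrier R'. h x = g" if "g \<in> carrier skew_quot" for g
    using bij that unfolding bij_betw_def by (metis imageE)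
  have hS: "h x \<in> carrier skew_quot" if "x \<in> carrier R'" for x by (rule ring_hom_closed[OF hh that])
  have h0: "h \<zero>\<^bsub>R'\<^esub> = \<zero>\<^bsub>skew_quot\<^esub>"
  proof -
    have "h \<zero>\<^bsub>R'\<^esub> n \<oplus> h \<zero>\<^bsub>R'\<^esub> n = h \<zero>\<^bsub>R'\<^esub> n" for n
      using fun_cong[OF ring_hom_add[OF hh R'.zero_closed R'.zero_closed], of n]
      by (simp add: skew_quot_simps)
    then have "h \<zero>\<^bsub>R'\<^esub> n = \<zero>" for n
      using skew_quotD(1)[OF hS[OF R'.zero_closed], of n] by (metis add.l_cancel_one)
    then show ?thesis by (auto simp: skew_quot_simps)
  qed
  show "simple_ring R'"
    unfolding simple_ring_def
  proof (intro conjI allI impI R')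
    have "\<one>\<^bsub>skew_quot\<^esub> \<noteq> \<zero>\<^bsub>skew_quot\<^esub>"
      using one_neq_zero by (auto simp: skew_quot_simps monomial_def fun_eq_iff)
    then show "\<one>\<^bsub>R'\<^esub> \<noteq> \<zero>\<^bsub>R'\<^esub>" using h0 ring_hom_one[OF hh] by metis
    fix I assume I: "ideal I R'"
    interpret I: ideal I R' by (rule I)
    show "I = {\<zero>\<^bsub>R'\<^esub>} \<or> I = carrier R'"
    proof (cases "I \<subseteq> {\<zero>\<^bsub>R'\<^esub>}")
      case True
      then show ?thesis using I.zero_closed by auto
    next
      case False
      then obtain x0 where x0: "x0 \<in> I" "x0 \<noteq> \<zero>\<^bsub>R'\<^esub>" by auto
      have Ic: "x \<in> carrier R'" if "x \<in> I" for x using that by (rule I.Icarr)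
      have "\<one>\<^bsub>skew_quot\<^esub> \<in> h ` I"
      proof (rule one_in_twosided)
        show "h ` I \<subseteq> carrier skew_quot" using hS Ic by auto
        show "h x0 \<in> h ` I" using x0 by simp
        show "h x0 \<noteq> \<zero>\<^bsub>skew_quot\<^esub>" using inj[OF Ic[OF x0(1)] R'.zero_closed] x0(2) h0 by simp
      next
        fix x y assume "x \<in> h ` I" "y \<in> h ` I"
        then obtain a b where ab: "a \<in> I" "b \<in> I" "x = h a" "y = h b" by auto
        then show "x \<oplus>\<^bsub>skew_quot\<^esub> y \<in> h ` I"
          using ring_hom_add[OF hh Ic[OF ab(1)] Ic[OF ab(2)]] I.a_closed[OF ab(1,2)]
          by (metis image_eqI)
      next
        fix x g assume "x \<in> h ` I" "g \<in> carrier skew_quot"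
        then obtain a b where ab: "a \<in> I" "x = h a" "b \<in> carrier R'" "g = h b"
          using surj by blast
        show "g \<otimes>\<^bsub>skew_quot\<^esub> x \<in> h ` I"
          using ring_hom_mult[OF hh ab(3) Ic[OF ab(1)]] I.I_l_closed[OF ab(1,3)] ab(2,4)
          by (metis image_eqI)
        show "x \<otimes>\<^bsub>skew_quot\<^esub> g \<in> h ` I"
          using ring_hom_mult[OF hh Ic[OF ab(1)] ab(3)] I.I_r_closed[OF ab(1,3)] ab(2,4)
          by (metis image_eqI)
      qed
      then obtain x where "x \<in> I" "h x = h \<one>\<^bsub>R'\<^esub>" using ring_hom_one[OF hh] by auto
      then have "\<one>\<^bsub>R'\<^esub> \<in> I" using inj Ic by auto
      then show ?thesis using I.one_imp_carrier by blast
    qed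
  qed
  have cent: "x \<in> ring_center R' \<longleftrightarrow> x \<in> carrier R' \<and> h x \<in> ring_center skew_quot" for x
  proof (cases "x \<in> carrier R'")
    case True
    have "x \<in> ring_center R' \<longleftrightarrow> (\<forall>y\<in>carrier R'. h (x \<otimes>\<^bsub>R'\<^esub> y) = h (y \<otimes>\<^bsub>R'\<^esub> x))"
      using True inj by (simp add: ring_center_def)
    also have "\<dots> \<longleftrightarrow> (\<forall>y\<in>carrier R'. h x \<otimes>\<^bsub>skew_quot\<^esub> h y = h y \<otimes>\<^bsub>skew_quot\<^esub> h x)"
      using ring_hom_mult[OF hh] True by simp
    also have "\<dots> \<longleftrightarrow> (\<forall>g\<in>carrier skew_quot. h x \<otimes>\<^bsub>skew_quot\<^esub> g = g \<otimes>\<^bsub>skew_quot\<^esub> h x)"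
      using surj hS by metis
    also have "\<dots> \<longleftrightarrow> h x \<in> ring_center skew_quot" using hS[OF True] by (simp add: ring_center_def)
    finally show ?thesis using True by simp
  qed (auto simp: ring_center_def)
  define \<beta> where "\<beta> x = h x 0" for x
  have \<beta>: "h x = monomial (\<beta> x) 0" "\<beta> x \<in> ring_center R" "\<tau> (\<beta> x) = \<beta> x" "x \<in> carrier R'"
    if "x \<in> ring_center R'" for x
    using that cent[of x] by (auto simp: center_skew_quot \<beta>_def monomial_def)
  have \<beta>c: "\<beta> x \<in> carrier R" if "x \<in> ring_center R'" for x
    using \<beta>(2)[OF that] by (simp add: ring_center_def)
  have "\<beta> \<in> ring_hom (R'\<lparr>carrier := ring_center R'\<rparr>) R"
  proof (rule ring_hom_memI)
    show "\<beta> \<one>\<^bsub>R'\<lparr>carrier := ring_center R'\<rparr>\<^esub> = \<one>"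
      using ring_hom_one[OF hh] by (simp add: \<beta>_def skew_quot_simps monomial_def)
    fix x y assume "x \<in> carrier (R'\<lparr>carrier := ring_center R'\<rparr>)"
      "y \<in> carrier (R'\<lparr>carrier := ring_center R'\<rparr>)"
    then have xy: "x \<in> ring_center R'" "y \<in> ring_center R'" by auto
    show "\<beta> x \<in> carrier R" by (rule \<beta>c[OF xy(1)])
    have "h (x \<otimes>\<^bsub>R'\<^esub> y) = monomial (\<beta> x) 0 \<otimes>\<^bsub>skew_quot\<^esub> h y"
      using ring_hom_mult[OF hh \<beta>(4)[OF xy(1)] \<beta>(4)[OF xy(2)]] \<beta>(1)[OF xy(1)] by simp
    then show "\<beta> (x \<otimes>\<^bsub>R'\<lparr>carrier := ring_center R'\<rparr>\<^esub> y) = \<beta> x \<otimes> \<beta> y"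
      unfolding const_mult[OF \<beta>c[OF xy(1)] hS[OF \<beta>(4)[OF xy(2)]]] by (simp add: \<beta>_def)
    show "\<beta> (x \<oplus>\<^bsub>R'\<lparr>carrier := ring_center R'\<rparr>\<^esub> y) = \<beta> x \<oplus> \<beta> y"
      using ring_hom_add[OF hh \<beta>(4)[OF xy(1)] \<beta>(4)[OF xy(2)]] by (simp add: \<beta>_def skew_quot_simps)
  qed
  moreover have "\<beta> ` ring_center R' = {z \<in> ring_center R. \<tau> z = z}"
  proof
    show "\<beta> ` ring_center R' \<subseteq> {z \<in> ring_center R. \<tau> z = z}" using \<beta>(2,3) by blast
    show "{z \<in> ring_center R. \<tau> z = z} \<subseteq> \<beta> ` ring_center R'"
    proof
      fix z assume z: "z \<in> {z \<in> ring_center R. \<tau> z = z}"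
      then have zS: "monomial z 0 \<in> ring_center skew_quot" by (auto simp: center_skew_quot)
      then have "monomial z 0 \<in> carrier skew_quot" by (simp add: ring_center_def)
      then obtain x where x: "x \<in> carrier R'" "h x = monomial z 0" using surj by blast
      then have "x \<in> ring_center R'" "\<beta> x = z" using cent[of x] zS by (auto simp: \<beta>_def monomial_def)
      then show "z \<in> \<beta> ` ring_center R'" by blast
    qed
  qed
  moreover have "\<beta> x = a" if "h x = const_poly R a" for x a
    using that by (simp add: \<beta>_def const_poly_def)
  ultimately show "\<exists>\<beta>\<in>ring_hom (R'\<lparr>carrier := ring_center R'\<rparr>) R.
      \<beta> ` ring_center R' = {z \<in> ring_center R. \<tau> z = z} \<and>
      (\<forall>x\<in>ring_center R'. \<forall>a. h x = const_poly R a \<longrightarrow> \<beta> x = a)"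
    by blast
qed

end

section \<open>Groups fixing the images of the centres\<close>

definition fixing_group :: "('a, 'b) ring_scheme \<Rightarrow> 'a set \<Rightarrow> 'a set \<Rightarrow> ('a \<Rightarrow> 'a) set"
  where "fixing_group L K Y = {\<gamma> \<in> carrier (field_aut_group L K (carrier L)). \<forall>x\<in>Y. \<gamma> x = x}"

lemma (in field) field_aut_group_apply:
  assumes K: "K \<subseteq> carrier R"
  defines "\<Gamma> \<equiv> field_aut_group R K (carrier R)"
  shows "group \<Gamma>"
    and "\<gamma> \<in> carrier \<Gamma> \<Longrightarrow> \<gamma> \<in> ring_hom R R"
    and "\<gamma> \<in> carrier \<Gamma> \<Longrightarrow> x \<in> carrier R \<Longrightarrow> \<gamma> x \<in> carrier R"
    and "\<gamma> \<in> carrier \<Gamma> \<Longrightarrow> \<delta> \<in> carrier \<Gamma> \<Longrightarrow> x \<in> carrier R \<Longrightarrow> (\<gamma> \<otimes>\<^bsub>\<Gamma>\<^esub> \<delta>) x = \<gamma> (\<delta> x)"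
    and "\<gamma> \<in> carrier \<Gamma> \<Longrightarrow> x \<in> carrier R \<Longrightarrow> (inv\<^bsub>\<Gamma>\<^esub> \<gamma>) (\<gamma> x) = x"
    and "\<gamma> \<in> carrier \<Gamma> \<Longrightarrow> x \<in> carrier R \<Longrightarrow> \<gamma> ((inv\<^bsub>\<Gamma>\<^esub> \<gamma>) x) = x"
proof -
  show grp: "group \<Gamma>" unfolding \<Gamma>_def by (rule group_field_aut_group[OF carrier_is_subring K])
  show "\<gamma> \<in> carrier \<Gamma> \<Longrightarrow> \<gamma> \<in> ring_hom R R" for \<gamma>
    unfolding \<Gamma>_def using field_aut_groupD(4) by (fastforce simp: ring_hom_def)
  show "\<gamma> \<in> carrier \<Gamma> \<Longrightarrow> x \<in> carrier R \<Longrightarrow> \<gamma> x \<in> carrier R" for \<gamma>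
    unfolding \<Gamma>_def by (rule field_aut_groupD(6))
  show mult: "\<gamma> \<in> carrier \<Gamma> \<Longrightarrow> \<delta> \<in> carrier \<Gamma> \<Longrightarrow> x \<in> carrier R \<Longrightarrow> (\<gamma> \<otimes>\<^bsub>\<Gamma>\<^esub> \<delta>) x = \<gamma> (\<delta> x)" for \<gamma> \<delta>
    unfolding \<Gamma>_def by (simp add: field_aut_group_simps compose_def)
  have one: "\<one>\<^bsub>\<Gamma>\<^esub> x = x" if "x \<in> carrier R"
    using that by (simp add: \<Gamma>_def field_aut_group_simps)
  interpret group \<Gamma> by (rule grp)
  show "\<gamma> \<in> carrier \<Gamma> \<Longrightarrow> x \<in> carrier R \<Longrightarrow> (inv\<^bsub>\<Gamma>\<^esub> \<gamma>) (\<gamma> x) = x"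
    using mult[of "inv\<^bsub>\<Gamma>\<^esub> \<gamma>" \<gamma>] one by simp
  show "\<gamma> \<in> carrier \<Gamma> \<Longrightarrow> x \<in> carrier R \<Longrightarrow> \<gamma> ((inv\<^bsub>\<Gamma>\<^esub> \<gamma>) x) = x"
    using mult[of \<gamma> "inv\<^bsub>\<Gamma>\<^esub> \<gamma>"] one by simp
qed

lemma (in field) subgroup_fixing_group:
  assumes K: "K \<subseteq> carrier R" and Y: "Y \<subseteq> carrier R"
  shows "subgroup (fixing_group R K Y) (field_aut_group R K (carrier R))"
proof -
  note fag = field_aut_group_apply[OF K]
  interpret G: group "field_aut_group R K (carrier R)" by (rule fag(1))
  show ?thesis
  proof
    show "fixing_group R K Y \<subseteq> carrier (field_aut_group R K (carrier R))" by (auto simp: fixing_group_def)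
    show "\<one>\<^bsub>field_aut_group R K (carrier R)\<^esub> \<in> fixing_group R K Y"
      using Y G.one_closed by (auto simp: fixing_group_def field_aut_group_simps(1))
    show "s \<otimes>\<^bsub>field_aut_group R K (carrier R)\<^esub> t \<in> fixing_group R K Y" if "s \<in> fixing_group R K Y" "t \<in> fixing_group R K Y" for s t
      using that fag(4) Y by (auto simp: fixing_group_def subset_iff)
    show "inv\<^bsub>field_aut_group R K (carrier R)\<^esub> s \<in> fixing_group R K Y" if "s \<in> fixing_group R K Y" for s
    proof -
      have s: "s \<in> carrier (field_aut_group R K (carrier R))" "\<And>x. x \<in> Y \<Longrightarrow> s x = x"
        using that by (auto simp: fixing_group_def)
      have "(inv\<^bsub>field_aut_group R K (carrier R)\<^esub> s) x = x" if "x \<in> Y" for x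
        using fag(5)[OF s(1), of x] s(2)[OF that] that Y by auto
      then show ?thesis using s(1) by (simp add: fixing_group_def)
    qed
  qed
qed

text \<open>An element fixing the image of the fixed field of \<open>t\<close> acts on the image of \<open>E\<close> as a power of
  \<open>t\<close>. Such actions commute, so commutators fix the image of \<open>E\<close> pointwise. The powers of \<open>t\<close> are
  restricted to \<open>E\<close> since the group of bijections consists of extensional functions.\<close>

lemma (in field) derived_fixing_group_cyclic:
  assumes K: "K \<subseteq> carrier R" and E: "field E"
    and f: "f \<in> ring_hom E R" and t: "t \<in> ring_iso E E"
    and q: "0 < q" and tq: "\<And>z. z \<in> carrier E \<Longrightarrow> (t ^^ q) z = z"
  shows "derived (field_aut_group R K (carrier R)) (fixing_group R K (f ` {z \<in> carrier E. t z = z}))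
    \<subseteq> fixing_group R K (f ` carrier E)"
proof -
  let ?\<Gamma> = "field_aut_group R K (carrier R)" and ?C = "carrier E"
  let ?P = "fixing_group R K (f ` {z \<in> ?C. t z = z})" and ?Q = "fixing_group R K (f ` ?C)"
  interpret E: field E by (rule E)
  note fag = field_aut_group_apply[OF K]
  interpret G: group ?\<Gamma> by (rule fag(1))
  have fc: "f x \<in> carrier R" if "x \<in> ?C" for x by (rule ring_hom_closed[OF f that])
  have Psub: "subgroup ?P ?\<Gamma>" and Qsub: "subgroup ?Q ?\<Gamma>"
    by (rule subgroup_fixing_group[OF K], use fc in auto)+
  have hom: "t ^^ j \<in> ring_hom E E" for j
    using funpow_ring_iso[OF t, of j] by (simp add: ring_iso_def)
  have tc: "(t ^^ j) x \<in> ?C" if "x \<in> ?C" for j x by (rule ring_hom_closed[OF hom that])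
  have tmod: "(t ^^ j) x = (t ^^ (j mod q)) x" if x: "x \<in> ?C" for j x
  proof -
    have m: "(t ^^ (q * m)) x = x" for m
      by (induction m) (simp_all add: funpow_add tq x)
    have "(t ^^ j) x = (t ^^ (j mod q + q * (j div q))) x" by simp
    also have "\<dots> = (t ^^ (j mod q)) ((t ^^ (q * (j div q))) x)"
      by (simp only: funpow_add comp_apply)
    finally show ?thesis by (simp add: m)
  qed
  define S where "S = (\<lambda>j. restrict (t ^^ j) ?C) ` {..<q}"
  have S_mem: "restrict (t ^^ j) ?C \<in> S" for j
  proof -
    have "restrict (t ^^ j) ?C = restrict (t ^^ (j mod q)) ?C"
      by (rule restrict_ext) (rule tmod)
    then show ?thesis using q by (auto simp: S_def)
  qed
  have comp: "compose ?C (restrict (t ^^ i) ?C) (restrict (t ^^ j) ?C) = restrict (t ^^ (i + j)) ?C" for i j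
    using tc by (auto simp: compose_def funpow_add)
  have Sbij: "restrict (t ^^ j) ?C \<in> Bij ?C" for j
  proof -
    have "bij_betw (t ^^ j) ?C ?C" using funpow_ring_iso[OF t, of j] by (simp add: ring_iso_def)
    then show ?thesis by (auto simp: Bij_def)
  qed
  have mult: "restrict (t ^^ i) ?C \<otimes>\<^bsub>BijGroup ?C\<^esub> restrict (t ^^ j) ?C = restrict (t ^^ (i + j)) ?C" for i j
    using Sbij comp by (simp add: BijGroup_def)
  interpret BG: group "BijGroup ?C" by (rule group_BijGroup)
  have SB: "restrict (t ^^ j) ?C \<in> carrier (BijGroup ?C)" for j
    using Sbij by (simp add: BijGroup_def)
  have one: "restrict (t ^^ 0) ?C = \<one>\<^bsub>BijGroup ?C\<^esub>" by (auto simp: BijGroup_def)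
  have Ssub: "subgroup S (BijGroup ?C)"
  proof (rule BG.subgroupI)
    show "S \<subseteq> carrier (BijGroup ?C)" using SB by (auto simp: S_def)
    show "S \<noteq> {}" using q by (auto simp: S_def)
    fix a assume "a \<in> S"
    then obtain i where i: "i < q" "a = restrict (t ^^ i) ?C" by (auto simp: S_def)
    have "restrict (t ^^ (q - i)) ?C \<otimes>\<^bsub>BijGroup ?C\<^esub> a = restrict (t ^^ q) ?C"
      using i by (simp add: mult)
    also have "\<dots> = \<one>\<^bsub>BijGroup ?C\<^esub>" using tq by (auto simp: BijGroup_def)
    finally have "inv\<^bsub>BijGroup ?C\<^esub> a = restrict (t ^^ (q - i)) ?C"
      using SB i(2) by (intro BG.inv_equality) auto
    then show "inv\<^bsub>BijGroup ?C\<^esub> a \<in> S" using S_mem by simp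
    fix b assume "b \<in> S"
    then obtain j where "b = restrict (t ^^ j) ?C" by (auto simp: S_def)
    then show "a \<otimes>\<^bsub>BijGroup ?C\<^esub> b \<in> S" using i S_mem by (simp add: mult)
  qed
  have power: "\<exists>j. \<forall>x\<in>?C. \<gamma> (f x) = f ((t ^^ j) x)" if \<gamma>: "\<gamma> \<in> ?P" for \<gamma>
  proof -
    have \<gamma>G: "\<gamma> \<in> carrier ?\<Gamma>" using \<gamma> by (simp add: fixing_group_def)
    have "\<exists>s\<in>S. \<forall>x\<in>?C. (\<gamma> \<circ> f) x = f (s x)"
    proof (rule homs_eq_on_fixed_field[OF E Ssub _ _ f])
      show "finite S" by (simp add: S_def)
      show "S \<subseteq> ring_hom E E" using hom by (auto simp: S_def ring_hom_def)
      show "\<gamma> \<circ> f \<in> ring_hom E R" by (rule ring_hom_trans[OF f fag(2)[OF \<gamma>G]])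
      fix x assume "x \<in> fixed_points S ?C"
      then have x: "x \<in> ?C" and "restrict (t ^^ 1) ?C x = x"
        using S_mem[of 1] unfolding fixed_points_def by blast+
      then have "t x = x" by simp
      with x show "f x = (\<gamma> \<circ> f) x" using \<gamma> by (auto simp: fixing_group_def)
    qed
    then obtain s where s: "s \<in> S" "\<forall>x\<in>?C. (\<gamma> \<circ> f) x = f (s x)" by blast
    then obtain j where "s = restrict (t ^^ j) ?C" by (auto simp: S_def)
    with s show ?thesis by (intro exI[of _ j]) auto
  qed
  have "derived_set ?\<Gamma> ?P \<subseteq> ?Q"
  proof
    fix \<kappa> assume "\<kappa> \<in> derived_set ?\<Gamma> ?P"
    then obtain \<gamma> \<delta> where m: "\<gamma> \<in> ?P" "\<delta> \<in> ?P"
      and \<kappa>: "\<kappa> = \<gamma> \<otimes>\<^bsub>?\<Gamma>\<^esub> \<delta> \<otimes>\<^bsub>?\<Gamma>\<^esub> inv\<^bsub>?\<Gamma>\<^esub> \<gamma> \<otimes>\<^bsub>?\<Gamma>\<^esub> inv\<^bsub>?\<Gamma>\<^esub> \<delta>" by blast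
    have mG: "\<gamma> \<in> carrier ?\<Gamma>" "\<delta> \<in> carrier ?\<Gamma>" using m by (auto simp: fixing_group_def)
    \<comment> \<open>The commutator is \<open>\<eta> \<theta>\<^sup>-\<^sup>1\<close> for the two products \<open>\<eta> = \<gamma>\<delta>\<close> and \<open>\<theta> = \<delta>\<gamma>\<close>, which agree on the
      image of \<open>E\<close>; and \<open>\<theta>\<^sup>-\<^sup>1\<close> maps this image into itself.\<close>
    let ?\<theta> = "\<delta> \<otimes>\<^bsub>?\<Gamma>\<^esub> \<gamma>" and ?\<eta> = "\<gamma> \<otimes>\<^bsub>?\<Gamma>\<^esub> \<delta>"
    have \<theta>P: "inv\<^bsub>?\<Gamma>\<^esub> ?\<theta> \<in> ?P"
      using Psub m by (intro subgroup.m_inv_closed[OF Psub] subgroup.m_closed[OF Psub])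
    have \<kappa>': "\<kappa> = ?\<eta> \<otimes>\<^bsub>?\<Gamma>\<^esub> inv\<^bsub>?\<Gamma>\<^esub> ?\<theta>"
      unfolding \<kappa> using mG by (simp add: G.inv_mult_group G.m_assoc)
    obtain i j where ij: "\<And>x. x \<in> ?C \<Longrightarrow> \<gamma> (f x) = f ((t ^^ i) x)"
        "\<And>x. x \<in> ?C \<Longrightarrow> \<delta> (f x) = f ((t ^^ j) x)"
      using power[OF m(1)] power[OF m(2)] by blast
    obtain l where l: "\<And>x. x \<in> ?C \<Longrightarrow> (inv\<^bsub>?\<Gamma>\<^esub> ?\<theta>) (f x) = f ((t ^^ l) x)"
      using power[OF \<theta>P] by blast
    have \<eta>\<theta>: "?\<eta> (f x) = ?\<theta> (f x)" if x: "x \<in> ?C" for x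
    proof -
      have "?\<eta> (f x) = f ((t ^^ i) ((t ^^ j) x))"
        using x tc fc mG by (simp add: fag(4) ij)
      also have "(t ^^ i) ((t ^^ j) x) = (t ^^ j) ((t ^^ i) x)"
        by (metis add.commute comp_apply funpow_add)
      also have "f \<dots> = ?\<theta> (f x)"
        using x tc fc mG by (simp add: fag(4) ij)
      finally show ?thesis .
    qed
    have "\<kappa> (f x) = f x" if x: "x \<in> ?C" for x
    proof -
      have "\<kappa> (f x) = ?\<eta> (f ((t ^^ l) x))"
        unfolding \<kappa>' using x fc mG by (simp add: fag(4) l)
      also have "\<dots> = ?\<theta> ((inv\<^bsub>?\<Gamma>\<^esub> ?\<theta>) (f x))" using \<eta>\<theta>[OF tc[OF x]] l[OF x] by simp
      also have "\<dots> = f x" using mG fc[OF x] by (intro fag(6)) auto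
      finally show ?thesis .
    qed
    moreover have "\<kappa> \<in> carrier ?\<Gamma>" using mG by (simp add: \<kappa>)
    ultimately show "\<kappa> \<in> ?Q" by (auto simp: fixing_group_def)
  qed
  then show ?thesis unfolding derived_def by (rule G.generate_subgroup_incl[OF _ Qsub])
qed

text \<open>Restriction to the image of \<open>K\<close> is a surjective homomorphism from the group fixing \<open>Z\<close> onto \<open>G\<close>:
  it lands in \<open>G\<close> because \<open>Z\<close> is the fixed field of the finite group \<open>G\<close>, and it is onto because
  automorphisms of \<open>K\<close> extend. It kills the elements fixing the image of \<open>K\<close>.\<close>

lemma (in field) solvable_of_derived_fixing_group:
  assumes K: "field K" and F: "F \<subseteq> carrier K"
    and \<iota>: "\<iota> \<in> ring_hom K R"
  defines "\<Gamma> \<equiv> field_aut_group R (\<iota> ` F) (carrier R)" and "G \<equiv> field_aut_group K F (carrier K)"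
  defines "Z \<equiv> fixed_points (carrier G) (carrier K)"
  assumes fin: "finite (carrier \<Gamma>)"
    and ext: "\<And>s. s \<in> carrier G \<Longrightarrow> \<exists>\<gamma>\<in>carrier \<Gamma>. \<forall>x\<in>carrier K. \<gamma> (\<iota> x) = \<iota> (s x)"
    and der: "(derived \<Gamma> ^^ n) (fixing_group R (\<iota> ` F) (\<iota> ` Z)) \<subseteq> fixing_group R (\<iota> ` F) (\<iota> ` carrier K)"
  shows "solvable G"
proof -
  interpret K: field K by (rule K)
  let ?M = "carrier K" and ?P = "fixing_group R (\<iota> ` F) (\<iota> ` Z)"
  have \<iota>c: "\<iota> x \<in> carrier R" if "x \<in> ?M" for x by (rule ring_hom_closed[OF \<iota> that])
  have \<iota>F: "\<iota> ` F \<subseteq> carrier R" using \<iota>c F by auto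
  note fag = field_aut_group_apply[OF \<iota>F, folded \<Gamma>_def]
  have inj: "inj_on \<iota> ?M" by (rule non_trivial_field_hom_is_inj[OF \<iota> K field_axioms])
  interpret \<Gamma>: group \<Gamma> by (rule fag(1))
  interpret G: group G unfolding G_def by (rule K.group_field_aut_group[OF K.carrier_is_subring F])
  have GM: "s x \<in> ?M" if "s \<in> carrier G" "x \<in> ?M" for s x
    using that field_aut_groupD(6) unfolding G_def by fast
  have Gext: "s \<in> extensional ?M" if "s \<in> carrier G" for s
    using that field_aut_groupD(2) unfolding G_def by fast
  have Gsub: "subgroup (carrier G) (BijGroup ?M)"
    unfolding G_def by (rule K.subgroup_field_aut_group[OF K.carrier_is_subring F])
  have Ghom: "s \<in> ring_hom K K" if "s \<in> carrier G" for s
    using field_aut_groupD(4)[of s K F ?M] that unfolding G_def by simp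
  define \<rho> where "\<rho> \<gamma> = restrict (\<lambda>x. inv_into ?M \<iota> (\<gamma> (\<iota> x))) ?M" for \<gamma>
  have \<rho>_eq: "\<rho> \<gamma> = s" if "s \<in> carrier G" "\<And>x. x \<in> ?M \<Longrightarrow> \<gamma> (\<iota> x) = \<iota> (s x)" for \<gamma> s
  proof (rule extensionalityI[of _ ?M])
    show "\<rho> \<gamma> x = s x" if "x \<in> ?M" for x
      using that \<open>\<And>x. x \<in> ?M \<Longrightarrow> \<gamma> (\<iota> x) = \<iota> (s x)\<close> GM[OF \<open>s \<in> carrier G\<close>] inj
      by (simp add: \<rho>_def)
  qed (use Gext that in \<open>auto simp: \<rho>_def\<close>)
  have finG: "finite (carrier G)"
  proof (rule finite_subset)
    show "carrier G \<subseteq> \<rho> ` carrier \<Gamma>"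
    proof
      fix s assume s: "s \<in> carrier G"
      then obtain \<gamma> where "\<gamma> \<in> carrier \<Gamma>" "\<forall>x\<in>?M. \<gamma> (\<iota> x) = \<iota> (s x)" using ext by blast
      with \<rho>_eq[OF s, of \<gamma>] show "s \<in> \<rho> ` carrier \<Gamma>" by blast
    qed
  qed (simp add: fin)
  have PG: "subgroup ?P \<Gamma>"
    unfolding \<Gamma>_def by (rule subgroup_fixing_group[OF \<iota>F]) (use \<iota>c in \<open>auto simp: Z_def fixed_points_def\<close>)
  have PC: "\<gamma> \<in> carrier \<Gamma>" if "\<gamma> \<in> ?P" for \<gamma> using that by (simp add: fixing_group_def \<Gamma>_def)
  have \<rho>: "\<rho> \<gamma> \<in> carrier G \<and> (\<forall>x\<in>?M. \<gamma> (\<iota> x) = \<iota> (\<rho> \<gamma> x))" if \<gamma>: "\<gamma> \<in> ?P" for \<gamma>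
  proof -
    have "\<exists>s\<in>carrier G. \<forall>x\<in>?M. (\<gamma> \<circ> \<iota>) x = \<iota> (s x)"
    proof (rule homs_eq_on_fixed_field[OF K Gsub finG _ \<iota>])
      show "carrier G \<subseteq> ring_hom K K" using Ghom by blast
      show "\<gamma> \<circ> \<iota> \<in> ring_hom K R" by (rule ring_hom_trans[OF \<iota> fag(2)[OF PC[OF \<gamma>]]])
      show "\<iota> x = (\<gamma> \<circ> \<iota>) x" if "x \<in> fixed_points (carrier G) ?M" for x
        using that \<gamma> by (auto simp: fixing_group_def Z_def)
    qed
    then obtain s where s: "s \<in> carrier G" "\<forall>x\<in>?M. \<gamma> (\<iota> x) = \<iota> (s x)" by auto
    with \<rho>_eq[OF s(1), of \<gamma>] show ?thesis by auto
  qed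
  have surj: "\<rho> ` ?P = carrier G"
  proof
    show "\<rho> ` ?P \<subseteq> carrier G" using \<rho> by blast
    show "carrier G \<subseteq> \<rho> ` ?P"
    proof
      fix s assume s: "s \<in> carrier G"
      then obtain \<gamma> where \<gamma>: "\<gamma> \<in> carrier \<Gamma>" "\<forall>x\<in>?M. \<gamma> (\<iota> x) = \<iota> (s x)" using ext by blast
      have "\<gamma> (\<iota> z) = \<iota> z" if "z \<in> Z" for z
        using that \<gamma>(2) s by (auto simp: Z_def fixed_points_def)
      then have "\<gamma> \<in> ?P" using \<gamma>(1) by (auto simp: fixing_group_def \<Gamma>_def)
      moreover have "\<rho> \<gamma> = s" by (rule \<rho>_eq[OF s]) (use \<gamma>(2) in blast)
      ultimately show "s \<in> \<rho> ` ?P" by blast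
    qed
  qed
  have hom: "group_hom (\<Gamma>\<lparr>carrier := ?P\<rparr>) G \<rho>"
  proof (rule group_hom.intro)
    show "group (\<Gamma>\<lparr>carrier := ?P\<rparr>)" by (rule \<Gamma>.subgroup_imp_group[OF PG])
    show "group_hom_axioms (\<Gamma>\<lparr>carrier := ?P\<rparr>) G \<rho>"
    proof (rule group_hom_axioms.intro, rule homI)
      fix \<gamma> assume "\<gamma> \<in> carrier (\<Gamma>\<lparr>carrier := ?P\<rparr>)"
      then show "\<rho> \<gamma> \<in> carrier G" using \<rho> by simp
    next
      fix \<gamma> \<delta> assume "\<gamma> \<in> carrier (\<Gamma>\<lparr>carrier := ?P\<rparr>)" "\<delta> \<in> carrier (\<Gamma>\<lparr>carrier := ?P\<rparr>)"
      then have m: "\<gamma> \<in> ?P" "\<delta> \<in> ?P" by auto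
      have "\<rho> (\<gamma> \<otimes>\<^bsub>\<Gamma>\<^esub> \<delta>) = \<rho> \<gamma> \<otimes>\<^bsub>G\<^esub> \<rho> \<delta>"
      proof (rule \<rho>_eq)
        show "\<rho> \<gamma> \<otimes>\<^bsub>G\<^esub> \<rho> \<delta> \<in> carrier G" using \<rho>[OF m(1)] \<rho>[OF m(2)] by blast
        fix x assume x: "x \<in> ?M"
        have "(\<gamma> \<otimes>\<^bsub>\<Gamma>\<^esub> \<delta>) (\<iota> x) = \<gamma> (\<delta> (\<iota> x))" by (rule fag(4)[OF PC[OF m(1)] PC[OF m(2)] \<iota>c[OF x]])
        also have "\<dots> = \<iota> (\<rho> \<gamma> (\<rho> \<delta> x))" using \<rho>[OF m(1)] \<rho>[OF m(2)] x GM by simp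
        also have "\<rho> \<gamma> (\<rho> \<delta> x) = (\<rho> \<gamma> \<otimes>\<^bsub>G\<^esub> \<rho> \<delta>) x"
          using \<rho>[OF m(1)] \<rho>[OF m(2)] x unfolding G_def by (simp add: field_aut_group_simps(2) compose_def)
        finally show "(\<gamma> \<otimes>\<^bsub>\<Gamma>\<^esub> \<delta>) (\<iota> x) = \<iota> ((\<rho> \<gamma> \<otimes>\<^bsub>G\<^esub> \<rho> \<delta>) x)" .
      qed
      then show "\<rho> (\<gamma> \<otimes>\<^bsub>\<Gamma>\<lparr>carrier := ?P\<rparr>\<^esub> \<delta>) = \<rho> \<gamma> \<otimes>\<^bsub>G\<^esub> \<rho> \<delta>" by simp
    qed
  qed (rule G.is_group)
  have "(derived G ^^ n) (carrier G) = \<rho> ` ((derived \<Gamma> ^^ n) ?P)"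
    using group_hom.exp_of_derived_img[OF hom, of ?P n]
    by (simp add: surj \<Gamma>.derived_exp_subgroup_consistent[OF PG])
  also have "\<dots> \<subseteq> {\<one>\<^bsub>G\<^esub>}"
  proof clarify
    fix \<gamma> assume "\<gamma> \<in> (derived \<Gamma> ^^ n) ?P"
    then have "\<gamma> (\<iota> x) = \<iota> x" if "x \<in> ?M" for x using der that by (auto simp: fixing_group_def)
    then show "\<rho> \<gamma> = \<one>\<^bsub>G\<^esub>"
      by (intro \<rho>_eq[OF G.one_closed]) (simp add: G_def field_aut_group_simps(1))
  qed
  finally have "(derived G ^^ n) (carrier G) \<subseteq> {\<one>\<^bsub>G\<^esub>}" .
  moreover have "\<one>\<^bsub>G\<^esub> \<in> (derived G ^^ n) (carrier G)"
    by (rule subgroup.one_closed[OF G.exp_of_derived_is_subgroup[OF G.subgroup_self]])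
  ultimately have "(derived G ^^ n) (carrier G) = {\<one>\<^bsub>G\<^esub>}" by auto
  then show ?thesis using G.solvable_iff_trivial_derived_seq by blast
qed

section \<open>The chain of centres\<close>

theorem theorem8p10:
  fixes A :: "('a, 'b) ring_scheme" and F M :: "'a set" and G :: "('a \<Rightarrow> 'a) monoid"
    and n k :: nat and B :: "nat \<Rightarrow> 'a set"
    and \<tau> :: "nat \<Rightarrow> 'a \<Rightarrow> 'a" and q :: "nat \<Rightarrow> nat" and c :: "nat \<Rightarrow> 'a"
  assumes A: "central_simple_algebra A F n"
    and M: "subfield M A" "F \<subseteq> M" "ring.dimension A n F M"
    and G: "G = field_aut_group A F M" "carrier G \<noteq> {\<one>\<^bsub>G\<^esub>}"
    and chain: "B 0 = M" "\<forall>i<k. B i \<subset> B (Suc i)" "B k \<subseteq> carrier A"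
    and subalg: "\<forall>i\<le>k. subring (B i) A \<and> F \<subseteq> B i"
    and maxsub: "\<forall>i\<le>k. maximal_subfield M (A\<lparr>carrier := B i\<rparr>)"
    and crossed: "crossed_product_algebra (A\<lparr>carrier := B k\<rparr>) (fixed_points (carrier G) M) M G"
    and iso: "\<forall>i<k. algebra_isomorphic F (A\<lparr>carrier := B (Suc i)\<rparr>)
      (skew_poly_quotient (A\<lparr>carrier := B i\<rparr>) (\<tau> i)
        (skew_binomial (A\<lparr>carrier := B i\<rparr>) (\<tau> i) (q i) (c i)))
      (const_poly (A\<lparr>carrier := B i\<rparr>))"
    and q: "\<forall>i<k. Factorial_Ring.prime (q i)"
    and \<tau>: "\<forall>i<k. \<tau> i \<in> ring_iso (A\<lparr>carrier := B i\<rparr>) (A\<lparr>carrier := B i\<rparr>) \<and>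
      (\<forall>x\<in>F. \<tau> i x = x) \<and>
      has_inner_order (A\<lparr>carrier := B i\<rparr>) (\<tau> i) (q i) \<and>
      restrict (\<tau> i) M \<in> carrier G"
    and c: "\<forall>i<k. c i \<in> Units (A\<lparr>carrier := fixed_points {\<tau> i} (B i)\<rparr>)"
  shows "solvable G"
proof -
  have ring_A: "ring A" and FA: "subfield F A" and center_A: "ring_center A = F"
    using A by (auto simp: central_simple_algebra_def simple_ring_def)
  interpret A: ring A by (rule ring_A)
  let ?R = "\<lambda>i. A\<lparr>carrier := B i\<rparr>" and ?K = "A\<lparr>carrier := M\<rparr>"
  define Z where "Z i = ring_center (?R i)" for i
  have Rring: "ring (?R i)" if "i \<le> k" for i using A.subring_is_ring subalg that by blast
  have K: "field ?K" by (rule A.subfield_iff(2)[OF M(1)])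
  then interpret K: field ?K .
  have FB: "F \<subseteq> B i" if "i \<le> k" for i using subalg that by blast
  have BA: "B i \<subseteq> carrier A" if "i \<le> k" for i using subalg that subringE(1) by blast
  have FZ: "F \<subseteq> Z i" if "i \<le> k" for i
    using FB[OF that] BA[OF that] unfolding center_A[symmetric] by (auto simp: Z_def ring_center_def)
  have ZB: "Z i \<subseteq> B i" for i by (auto simp: Z_def ring_center_def)
  have prems: "cyclic_skew_quotient (?R i) (\<tau> i) (q i) (c i)" if i: "i < k" and s: "simple_ring (?R i)" for i
  proof -
    have c1: "c i \<in> fixed_points {\<tau> i} (B i)"
      "\<exists>d\<in>fixed_points {\<tau> i} (B i). d \<otimes>\<^bsub>A\<^esub> c i = \<one>\<^bsub>A\<^esub> \<and> c i \<otimes>\<^bsub>A\<^esub> d = \<one>\<^bsub>A\<^esub>"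
      using c i by (auto simp: Units_def)
    show ?thesis
      unfolding cyclic_skew_quotient_def cyclic_skew_quotient_axioms_def
      using Rring[of i] i s \<tau> q c1 prime_ge_2_nat
      by (auto simp: Units_def fixed_points_def)
  qed
  have simple_B: "simple_ring (?R i)" if "i \<le> k" for i
    using that
  proof (induction i)
    case 0
    show ?case using field_simple_ring[OF K] chain(1) by simp
  next
    case (Suc i)
    then interpret S: cyclic_skew_quotient "?R i" "\<tau> i" "q i" "c i" by (intro prems) auto
    have "i < k" using Suc.prems by simp
    then obtain h where "h \<in> ring_iso (?R (Suc i)) S.skew_quot"
      using iso unfolding algebra_isomorphic_def by blast
    then show ?case by (rule S.iso_simple[OF Rring[OF Suc.prems]])
  qed
  have Zfield: "field (A\<lparr>carrier := Z i\<rparr>)" if "i \<le> k" for i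
    using ring.field_ring_center[OF Rring[OF that] simple_B[OF that]] by (simp add: Z_def)
  have FK: "subfield F ?K"
    using K.subfield_iff(1)[of F] A.subfield_iff(2)[OF FA] M(2) by simp
  have "K.finite_dimension F (carrier ?K)"
    using A.finite_dimension_in_subring[OF FA subfieldE(1)[OF M(1)] M(2,3)] by simp
  from K.exists_normal_closure[OF FK this] obtain L :: "(('a list \<times> nat) multiset \<Rightarrow> 'a) ring" and \<iota>
    where L: "field L" and \<iota>: "\<iota> \<in> ring_hom ?K L"
      and fin: "finite (carrier (field_aut_group L (\<iota> ` F) (carrier L)))"
      and ext: "\<And>E g. subfield E ?K \<Longrightarrow> F \<subseteq> E \<Longrightarrow> g \<in> ring_hom (A\<lparr>carrier := E\<rparr>) L \<Longrightarrow>
        (\<forall>x\<in>F. g x = \<iota> x) \<Longrightarrow>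
        \<exists>\<gamma>\<in>carrier (field_aut_group L (\<iota> ` F) (carrier L)). \<forall>x\<in>E. \<gamma> (\<iota> x) = g x"
    by auto
  interpret L: field L by (rule L)
  let ?\<Gamma> = "field_aut_group L (\<iota> ` F) (carrier L)" and ?fix = "fixing_group L (\<iota> ` F)"
  have \<iota>c: "\<iota> x \<in> carrier L" if "x \<in> M" for x using ring_hom_closed[OF \<iota>] that by simp
  have \<iota>F: "\<iota> ` F \<subseteq> carrier L" using \<iota>c M(2) by auto
  note fag = L.field_aut_group_apply[OF \<iota>F]
  interpret \<Gamma>: group ?\<Gamma> by (rule fag(1))
  \<comment> \<open>The embedding of \<open>Z\<^sub>i\<close> into \<open>L\<close> and the bound on the derived series of the group fixing its
    image are built together, because the image at the next stage is the fixed field at this one.\<close>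
  have chain_step: "\<exists>f\<in>ring_hom (A\<lparr>carrier := Z i\<rparr>) L. (\<forall>x\<in>F. f x = \<iota> x) \<and>
      (derived ?\<Gamma> ^^ i) (?fix (f ` Z i)) \<subseteq> ?fix (\<iota> ` M)" if "i \<le> k" for i
    using that
  proof (induction i)
    case 0
    have "Z 0 = M" using K.m_comm chain(1) by (auto simp: Z_def ring_center_def)
    then show ?case using \<iota> by auto
  next
    case (Suc i)
    then have ik: "i \<le> k" "i < k" by auto
    obtain f where f: "f \<in> ring_hom (A\<lparr>carrier := Z i\<rparr>) L" "\<forall>x\<in>F. f x = \<iota> x"
        and sub: "(derived ?\<Gamma> ^^ i) (?fix (f ` Z i)) \<subseteq> ?fix (\<iota> ` M)"
      using Suc.IH[OF ik(1)] by blast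
    interpret R: ring "?R i" by (rule Rring[OF ik(1)])
    interpret S: cyclic_skew_quotient "?R i" "\<tau> i" "q i" "c i" by (rule prems[OF ik(2) simple_B[OF ik(1)]])
    obtain h where h: "h \<in> ring_iso (?R (Suc i)) S.skew_quot" "\<forall>a\<in>F. h a = const_poly (?R i) a"
      using iso ik(2) unfolding algebra_isomorphic_def by blast
    obtain \<beta> where \<beta>: "\<beta> \<in> ring_hom (A\<lparr>carrier := Z (Suc i)\<rparr>) (?R i)"
        "\<beta> ` Z (Suc i) = {z \<in> Z i. \<tau> i z = z}"
        "\<And>x a. x \<in> Z (Suc i) \<Longrightarrow> h x = const_poly (?R i) a \<Longrightarrow> \<beta> x = a"
      using S.iso_center[OF Rring[OF Suc.prems] h(1)] unfolding Z_def by auto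
    have "\<beta> z \<in> Z i" if "z \<in> Z (Suc i)" for z using that \<beta>(2) by blast
    then have "\<beta> \<in> ring_hom (A\<lparr>carrier := Z (Suc i)\<rparr>) (A\<lparr>carrier := Z i\<rparr>)"
      using \<beta>(1) by (simp add: ring_hom_def Pi_iff)
    from ring_hom_trans[OF this f(1)]
    have f': "f \<circ> \<beta> \<in> ring_hom (A\<lparr>carrier := Z (Suc i)\<rparr>) L" .
    have f'F: "(f \<circ> \<beta>) x = \<iota> x" if "x \<in> F" for x
      using that \<beta>(3)[of x x] h(2) FZ[OF Suc.prems] f(2) by auto
    have img: "(f \<circ> \<beta>) ` Z (Suc i) = f ` {z \<in> Z i. \<tau> i z = z}"
      using \<beta>(2) by (simp only: image_comp[symmetric])
    have "derived ?\<Gamma> (?fix (f ` {z \<in> carrier (A\<lparr>carrier := Z i\<rparr>). \<tau> i z = z}))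
        \<subseteq> ?fix (f ` carrier (A\<lparr>carrier := Z i\<rparr>))"
    proof (rule L.derived_fixing_group_cyclic[OF \<iota>F Zfield[OF ik(1)] f(1)])
      show "\<tau> i \<in> ring_iso (A\<lparr>carrier := Z i\<rparr>) (A\<lparr>carrier := Z i\<rparr>)"
        using R.ring_iso_center[of "\<tau> i"] \<tau> ik(2) by (simp add: Z_def)
      have ord: "has_inner_order (?R i) (\<tau> i) (q i)" using \<tau> ik(2) by blast
      then show "0 < q i" by (simp add: has_inner_order_def)
      fix z assume "z \<in> carrier (A\<lparr>carrier := Z i\<rparr>)"
      then have z: "z \<in> B i" "\<And>x. x \<in> B i \<Longrightarrow> z \<otimes>\<^bsub>A\<^esub> x = x \<otimes>\<^bsub>A\<^esub> z"
        by (auto simp: Z_def ring_center_def)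
      obtain u where u: "u \<in> Units (?R i)"
          "\<forall>x\<in>B i. (\<tau> i ^^ q i) x = u \<otimes>\<^bsub>A\<^esub> x \<otimes>\<^bsub>A\<^esub> inv\<^bsub>?R i\<^esub> u"
        using ord by (auto simp: has_inner_order_def inner_automorphism_def)
      have uc: "u \<in> B i" "inv\<^bsub>?R i\<^esub> u \<in> B i"
        using R.Units_closed[OF u(1)] R.Units_inv_closed[OF u(1)] by auto
      have "(\<tau> i ^^ q i) z = z \<otimes>\<^bsub>A\<^esub> u \<otimes>\<^bsub>A\<^esub> inv\<^bsub>?R i\<^esub> u" using u(2) z uc by simp
      also have "\<dots> = z \<otimes>\<^bsub>A\<^esub> (u \<otimes>\<^bsub>A\<^esub> inv\<^bsub>?R i\<^esub> u)"
        using R.m_assoc[of z u "inv\<^bsub>?R i\<^esub> u"] z(1) uc by simp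
      also have "\<dots> = z" using R.Units_r_inv[OF u(1)] R.r_one[of z] z(1) by simp
      finally show "(\<tau> i ^^ q i) z = z" .
    qed
    then have "derived ?\<Gamma> (?fix ((f \<circ> \<beta>) ` Z (Suc i))) \<subseteq> ?fix (f ` Z i)"
      unfolding img by simp
    from \<Gamma>.mono_exp_of_derived[OF this, of i] sub
    have "(derived ?\<Gamma> ^^ Suc i) (?fix ((f \<circ> \<beta>) ` Z (Suc i))) \<subseteq> ?fix (\<iota> ` M)"
      by (simp only: funpow_Suc_right comp_apply)
    then show ?case using f' f'F by blast
  qed
  have Zk: "Z k = fixed_points (carrier G) M"
    using crossed by (auto simp: crossed_product_algebra_def central_simple_algebra_def Z_def)
  then have ZM: "Z k \<subseteq> M" by (auto simp: fixed_points_def)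
  obtain f where f: "f \<in> ring_hom (A\<lparr>carrier := Z k\<rparr>) L" "\<forall>x\<in>F. f x = \<iota> x"
      and sub: "(derived ?\<Gamma> ^^ k) (?fix (f ` Z k)) \<subseteq> ?fix (\<iota> ` M)"
    using chain_step[of k] by blast
  have "subfield (Z k) ?K" using K.subfield_iff(1)[of "Z k"] Zfield[of k] ZM by simp
  \<comment> \<open>The embedding \<open>f\<close> of \<open>Fix(G)\<close> obtained along the chain and the inclusion differ by an element
    of the group, which conjugates the corresponding fixing groups.\<close>
  from ext[OF this FZ f] obtain \<gamma> where \<gamma>: "\<gamma> \<in> carrier ?\<Gamma>" "\<And>x. x \<in> Z k \<Longrightarrow> \<gamma> (\<iota> x) = f x"
    by blast
  let ?P = "?fix (\<iota> ` Z k)"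
  have "(\<lambda>x. \<gamma> \<otimes>\<^bsub>?\<Gamma>\<^esub> x \<otimes>\<^bsub>?\<Gamma>\<^esub> inv\<^bsub>?\<Gamma>\<^esub> \<gamma>) ` ?P \<subseteq> ?fix (f ` Z k)"
  proof clarify
    fix \<delta> assume "\<delta> \<in> ?P"
    then have \<delta>: "\<delta> \<in> carrier ?\<Gamma>" "\<And>z. z \<in> Z k \<Longrightarrow> \<delta> (\<iota> z) = \<iota> z" by (auto simp: fixing_group_def)
    have "(\<gamma> \<otimes>\<^bsub>?\<Gamma>\<^esub> \<delta> \<otimes>\<^bsub>?\<Gamma>\<^esub> inv\<^bsub>?\<Gamma>\<^esub> \<gamma>) (f z) = f z" if z: "z \<in> Z k" for z
    proof -
      have zL: "\<iota> z \<in> carrier L" "f z \<in> carrier L" using \<iota>c ZM z ring_hom_closed[OF f(1)] by auto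
      have "(inv\<^bsub>?\<Gamma>\<^esub> \<gamma>) (f z) = \<iota> z" using fag(5)[OF \<gamma>(1) zL(1)] \<gamma>(2)[OF z] by simp
      then show ?thesis using zL \<gamma> \<delta> z by (simp add: fag(4))
    qed
    then show "\<gamma> \<otimes>\<^bsub>?\<Gamma>\<^esub> \<delta> \<otimes>\<^bsub>?\<Gamma>\<^esub> inv\<^bsub>?\<Gamma>\<^esub> \<gamma> \<in> ?fix (f ` Z k)"
      using \<gamma>(1) \<delta>(1) by (auto simp: fixing_group_def)
  qed
  with sub have "(derived ?\<Gamma> ^^ k) ((\<lambda>x. \<gamma> \<otimes>\<^bsub>?\<Gamma>\<^esub> x \<otimes>\<^bsub>?\<Gamma>\<^esub> inv\<^bsub>?\<Gamma>\<^esub> \<gamma>) ` ?P) \<subseteq> ?fix (\<iota> ` M)"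
    using \<Gamma>.mono_exp_of_derived by blast
  moreover have "subgroup ?P ?\<Gamma>" "subgroup (?fix (\<iota> ` M)) ?\<Gamma>"
    by (rule L.subgroup_fixing_group[OF \<iota>F], use \<iota>c ZM in auto)+
  moreover have "?fix (\<iota> ` M) \<subseteq> ?P" using ZM by (auto simp: fixing_group_def)
  ultimately obtain n where n: "(derived ?\<Gamma> ^^ n) ?P \<subseteq> ?fix (\<iota> ` M)"
    using \<Gamma>.derived_exp_subset_of_conjugate[OF fin] \<gamma>(1) by blast
  have GK: "G = field_aut_group ?K F (carrier ?K)" unfolding G(1) by (simp add: field_aut_group_def)
  show ?thesis
    unfolding GK
  proof (rule L.solvable_of_derived_fixing_group[OF K _ \<iota> fin])
    show "F \<subseteq> carrier ?K" using M(2) by simp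
    show "(derived ?\<Gamma> ^^ n) (?fix (\<iota> ` fixed_points (carrier (field_aut_group ?K F (carrier ?K))) (carrier ?K)))
        \<subseteq> ?fix (\<iota> ` carrier ?K)"
      using n Zk unfolding GK by simp
    fix s assume s: "s \<in> carrier (field_aut_group ?K F (carrier ?K))"
    then have s': "s \<in> ring_hom ?K ?K" "\<And>x. x \<in> F \<Longrightarrow> s x = x"
      using field_aut_groupD(4,5)[OF s] by auto
    have "subfield M ?K" using K.carrier_is_subfield by simp
    from ext[OF this M(2) ring_hom_trans[OF s'(1) \<iota>]] s'(2)
    show "\<exists>\<gamma>\<in>carrier ?\<Gamma>. \<forall>x\<in>carrier ?K. \<gamma> (\<iota> x) = \<iota> (s x)" by auto
  qed
qed

end
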